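(* Let $K$ and $M$ be integers with $2\le M\le K$, let $q$ be a prime power and let $l\ge1$. The Randomized Selection-and-Code (RSC) protocols for the four cases below are scalar-linear PIR-CSI--II protocols with the following rates: (1) the RSC protocol of Case 1, for $M=2$ and any $q\ge2$, has rate $1$; (2) the RSC protocol of Case 2, for $3\le M\le\frac K2+1$ and any $q\ge2$, has rate $\frac12$; (3) the RSC protocol of Case 3, for $\frac{K+1}{2}\le M\le K-1$ and any $q\ge3$, has rate $\frac12$; (4) the RSC protocol of Case 4, for $M=K$ and any $q\ge3$, has rate $1$.
   Context: Setup. Let $\mathcal{K}=\{1,\dots,K\}$, $\mathbb{F}_q^{\times}=\mathbb{F}_q\setminus\{0\}$ and $L=l\log_2 q$. Let $\mathcal{S}$ be the set of all $M$-subsets of $\mathcal{K}$ and $\mathcal{C}$ the set of all length-$M$ sequences over $\mathbb{F}_q^{\times}$. Boldface denotes random variables, regular letters their realizations; entropies are in bits. A server stores messages $\mathbf{X}_1,\dots,\mathbf{X}_K$, i.i.d. uniform on $\mathbb{F}_{q^l}$; write $\mathbf{X}_{\mathcal{K}}=\{\mathbf{X}_1,\dots,\mathbf{X}_K\}$. A user wants $X_W$ ($W\in\mathcal{K}$) and knows $Y^{[S,C]}=\sum_{i\in S}c_iX_i$, where $S=\{i_1,\dots,i_M\}\in\mathcal{S}$ and $C=(c_{i_1},\dots,c_{i_M})\in\mathcal{C}$. $\mathbf{S}$ is uniform on $\mathcal{S}$, $\mathbf{C}$ is uniform on $\mathcal{C}$ and independent of $(\mathbf{W},\mathbf{S})$,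 and the messages are independent of $(\mathbf{W},\mathbf{S},\mathbf{C})$. Model II: given $\mathbf{S}=S$, $\mathbf{W}$ is uniform on $S$ (so $\mathds{1}_{\{\mathbf{W}\in\mathbf{S}\}}=1$). A protocol consists of a query $\mathbf{Q}$, a possibly stochastic function of $(\mathbf{W},\mathbf{S},\mathbf{C})$ only (extra randomness independent of the messages), and an answer $\mathbf{A}$, a deterministic function of $\mathbf{Q}$, $\mathds{1}_{\{\mathbf{W}\in\mathbf{S}\}}$ and $\mathbf{X}_{\mathcal{K}}$. It is a PIR-CSI--II protocol if, under Model II, it satisfies recoverability, $H(\mathbf{X}_{\mathbf{W}}\mid \mathbf{A},\mathbf{Q},\mathds{1}_{\{\mathbf{W}\in\mathbf{S}\}},\mathbf{Y}^{[\mathbf{S},\mathbf{C}]},\mathbf{W},\mathbf{S},\mathbf{C})=0$, and $W$-privacy, $I(\mathbf{W};\mathbf{Q}\mid \mathds{1}_{\{\mathbf{W}\in\mathbf{S}\}})=0$ (equivalently, for every query $Q$ of positive probability the conditional distribution of $\mathbf{W}$ given $\mathbf{Q}=Q$ is uniform on $\mathcal{K}$). Its rate is $L/H(\mathbf{A}\mid \mathds{1}_{\{\mathbf{W}\in\mathbf{S}\}}=1)$. It is scalar-linear if the answer consists only of linear combinations of $X_1,\dots,X_K$ with coefficients in $\mathbb{F}_q$. RSC protocols. Given $W\in S$ and $C$; all random choices are uniform unless stated otherwise and mutually independent. A query component is a pair $(U,V)$ with $U=(u_1,\dots,u_m)$ a list of distinct indices in $\mathcal{K}$ and $V=(b_1,\dots,b_m)$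 a sequence over $\mathbb{F}_q^\times$; the server's answer to it is $\sum_{j=1}^m b_jX_{u_j}$. Case 1 ($M=2$): the user selects the index $i=W$ with probability $\frac1K$, or $i=$ the other element of $S$ with probability $\frac{K-1}{K}$, and sends $Q=(U,V)$ with $U=(i)$, $V=(1)$. Case 2 ($3\le M\le\frac K2+1$): choose $r\in\{M-2,M-1\}$ with $\mathbb{P}(r=M-2)=\frac{2M-2}{K}$ and $\mathbb{P}(r=M-1)=1-\frac{2M-2}{K}$. If $r=M-1$, select $M-1$ random indices from $\mathcal{K}\setminus S$; if $r=M-2$, select $W$ together with $M-2$ random indices from $\mathcal{K}\setminus S$. Let $U_1$ be the elements of $S\setminus\{W\}$ in increasing order, $U_2$ the $M-1$ selected indices in increasing order, and $V$ the coefficients $c_i$, $i\in S\setminus\{W\}$, in increasing order of $i$. With $Q_i=(U_i,V)$ for $i=1,2$ and a random permutation $\sigma$ of $\{1,2\}$, the query is the ordered pair $(Q_{\sigma(1)},Q_{\sigma(2)})$. Case 3 ($\frac{K+1}{2}\le M\le K-1$): choose $s\in\{2M-K-1,2M-K\}$ with $\mathbb{P}(s=2M-K)=\frac{2K-2M}{K}$ and $\mathbb{P}(s=2M-K-1)=1-\frac{2K-2M}{K}$. If $s=2M-K$, select $2M-K$ random indices from $S\setminus\{W\}$; if $s=2M-K-1$, select $W$ together with $2M-K-1$ random indices from $S\setminus\{W\}$. Let $U_1$ be the elements of $S$ in increasing order, $U_2$ the union of the $2M-K$ selected indices and the $K-M$ indices of $\mathcal{K}\setminus S$, in increasing order, and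 $V$ the sequence of coefficients $c_i$, $i\in S$, in increasing order of $i$, except that $c_W$ is replaced by a random $c\in\mathbb{F}_q^\times\setminus\{c_W\}$. With $Q_i=(U_i,V)$ for $i=1,2$ and a random permutation $\sigma$ of $\{1,2\}$, the query is the ordered pair $(Q_{\sigma(1)},Q_{\sigma(2)})$. Case 4 ($M=K$): the query is $Q=(U,V)$ with $U=(1,\dots,K)$ and $V=(c_1,\dots,c_K)$ except that $c_W$ is replaced by a random $c\in\mathbb{F}_q^\times\setminus\{c_W\}$. In every case the server returns the answers to all query components, in the order sent. The user recovers $X_W$ directly if $X_W$ was requested in Case 1, and otherwise from $Y^{[S,C]}$ and the answer to $(U,V)$ (Cases 1, 4) or to $(U_1,V)$ (Cases 2, 3). *)

theory Defs
  imports "HOL-Probability.Probability" "HOL-Number_Theory.Prime_Powers"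
begin

section \<open>Shannon quantities of discrete random variables\<close>

text \<open>
  Random variables are functions on the outcomes of a pmf. The sample space is cut down to the
  support, so that for finite support all random variables are simple, and the quantities below
  are the (base 2) entropies of \<^locale>\<open>information_space\<close>.
\<close>

definition outcome_space :: "'s pmf \<Rightarrow> 's measure" where
  "outcome_space p = restrict_space (measure_pmf p) (set_pmf p)"

lemma space_outcome_space [simp]: "space (outcome_space p) = set_pmf p"
  by (simp add: outcome_space_def space_restrict_space)

lemma information_space_outcome_space: "information_space (outcome_space p) 2"
proof -
  have "prob_space (outcome_space p)"
    unfolding outcome_space_def
    by (rule prob_space_restrict_space) (auto simp: emeasure_pmf)
  then show ?thesis
    by (simp add: information_space_def information_space_axioms_def)
qed

definition value_space :: "'s pmf \<Rightarrow> ('s \<Rightarrow> 'a) \<Rightarrow> 'a measure" where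
  "value_space p X = count_space (X ` set_pmf p)"

definition ent :: "'s pmf \<Rightarrow> ('s \<Rightarrow> 'a) \<Rightarrow> real" where
  "ent p X = prob_space.entropy (outcome_space p) 2 (value_space p X) X"

definition cond_ent :: "'s pmf \<Rightarrow> ('s \<Rightarrow> 'a) \<Rightarrow> ('s \<Rightarrow> 'b) \<Rightarrow> real" where
  "cond_ent p X Y =
     prob_space.conditional_entropy (outcome_space p) 2 (value_space p X) (value_space p Y) X Y"

definition cond_mutual_inf ::
    "'s pmf \<Rightarrow> ('s \<Rightarrow> 'a) \<Rightarrow> ('s \<Rightarrow> 'b) \<Rightarrow> ('s \<Rightarrow> 'c) \<Rightarrow> real" where
  "cond_mutual_inf p X Y Z =
     prob_space.conditional_mutual_information (outcome_space p) 2
       (value_space p X) (value_space p Y) (value_space p Z) X Y Z"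

text \<open>\<open>H(X | E)\<close> for an event \<open>E\<close> of positive probability.\<close>

definition ent_given_event :: "'s pmf \<Rightarrow> ('s \<Rightarrow> 'a) \<Rightarrow> 's set \<Rightarrow> real" where
  "ent_given_event p X E = ent (cond_pmf p E) X"


section \<open>Messages, side information and the joint distribution\<close>

text \<open>
  The field $F_q$ is a finite field type \<open>'f\<close>, its extension $F_{q^l}$ a finite field type \<open>'e\<close>,
  the inclusion being a ring homomorphism \<open>'f \<Rightarrow> 'e\<close> (automatically injective).
\<close>

definition field_embedding :: "('f::field \<Rightarrow> 'e::field) \<Rightarrow> bool" where
  "field_embedding \<iota> \<longleftrightarrow>
     \<iota> 1 = 1 \<and> (\<forall>a b. \<iota> (a + b) = \<iota> a + \<iota> b) \<and> (\<forall>a b. \<iota> (a * b) = \<iota> a * \<iota> b)"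

definition indices :: "nat \<Rightarrow> nat set" where
  "indices K = {1..K}"

definition subsets_of_size :: "nat \<Rightarrow> nat set \<Rightarrow> nat set set" where
  "subsets_of_size n T = {S. S \<subseteq> T \<and> card S = n}"

definition coeff_seqs :: "nat \<Rightarrow> 'f::field list set" where
  "coeff_seqs M = {C. length C = M \<and> 0 \<notin> set C}"

definition message_vectors :: "nat \<Rightarrow> (nat \<Rightarrow> 'e::field) set" where
  "message_vectors K = indices K \<rightarrow>\<^sub>E UNIV"

text \<open>
  The coefficient \<open>c\<^sub>i\<close>, for \<open>i \<in> S = {i\<^sub>1 < \<dots> < i\<^sub>M}\<close> and \<open>C = (c\<^bsub>i\<^sub>1\<^esub>, \<dots>, c\<^bsub>i\<^sub>M\<^esub>)\<close>: the entry of \<open>C\<close>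
  (counting from 0) at the position of \<open>i\<close> in \<open>S\<close>.
\<close>

definition coef :: "nat set \<Rightarrow> 'f list \<Rightarrow> nat \<Rightarrow> 'f" where
  "coef S C i = C ! card {j \<in> S. j < i}"

definition side_info ::
    "('f::field \<Rightarrow> 'e::field) \<Rightarrow> nat set \<Rightarrow> 'f list \<Rightarrow> (nat \<Rightarrow> 'e) \<Rightarrow> 'e" where
  "side_info \<iota> S C x = (\<Sum>i\<in>S. \<iota> (coef S C i) * x i)"

text \<open>
  A query depends, besides private randomness, on \<open>(W, S, C)\<close> only; an answer is a function of the
  query, the value of the indicator of \<open>W \<in> S\<close>, and the messages.
\<close>

record ('f, 'e, 'q, 'a) protocol =
  query :: "nat \<Rightarrow> nat set \<Rightarrow> 'f list \<Rightarrow> 'q pmf"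
  answer :: "'q \<Rightarrow> nat \<Rightarrow> (nat \<Rightarrow> 'e) \<Rightarrow> 'a"

record ('f, 'e, 'q) outcome =
  rW :: nat
  rS :: "nat set"
  rC :: "'f list"
  rX :: "nat \<Rightarrow> 'e"
  rQ :: 'q

text \<open>The joint distribution under Model II: given \<open>S\<close>, the demand is uniform on \<open>S\<close>.\<close>

definition model_II ::
    "nat \<Rightarrow> nat \<Rightarrow> ('f::{field,finite}, 'e::{field,finite}, 'q, 'a) protocol
      \<Rightarrow> ('f, 'e, 'q) outcome pmf" where
  "model_II K M P = do {
     S \<leftarrow> pmf_of_set (subsets_of_size M (indices K));
     W \<leftarrow> pmf_of_set S;
     C \<leftarrow> pmf_of_set (coeff_seqs M);
     x \<leftarrow> pmf_of_set (message_vectors K);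
     Q \<leftarrow> query P W S C;
     return_pmf \<lparr>rW = W, rS = S, rC = C, rX = x, rQ = Q\<rparr>
   }"

definition rInd :: "('f, 'e, 'q) outcome \<Rightarrow> nat" where
  "rInd \<omega> = of_bool (rW \<omega> \<in> rS \<omega>)"

definition rA :: "('f, 'e, 'q, 'a) protocol \<Rightarrow> ('f, 'e, 'q) outcome \<Rightarrow> 'a" where
  "rA P \<omega> = answer P (rQ \<omega>) (rInd \<omega>) (rX \<omega>)"

definition rY :: "('f::field \<Rightarrow> 'e::field) \<Rightarrow> ('f, 'e, 'q) outcome \<Rightarrow> 'e" where
  "rY \<iota> \<omega> = side_info \<iota> (rS \<omega>) (rC \<omega>) (rX \<omega>)"


section \<open>PIR-CSI--II protocols\<close>

definition recoverability ::
    "('f::{field,finite} \<Rightarrow> 'e::{field,finite}) \<Rightarrow> nat \<Rightarrow> nat \<Rightarrow> ('f, 'e, 'q, 'a) protocol \<Rightarrow> bool" where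
  "recoverability \<iota> K M P \<longleftrightarrow>
     cond_ent (model_II K M P) (\<lambda>\<omega>. rX \<omega> (rW \<omega>))
       (\<lambda>\<omega>. (rA P \<omega>, rQ \<omega>, rInd \<omega>, rY \<iota> \<omega>, rW \<omega>, rS \<omega>, rC \<omega>)) = 0"

definition W_privacy ::
    "nat \<Rightarrow> nat \<Rightarrow> ('f::{field,finite}, 'e::{field,finite}, 'q, 'a) protocol \<Rightarrow> bool" where
  "W_privacy K M P \<longleftrightarrow> cond_mutual_inf (model_II K M P) rW rQ rInd = 0"

definition pir_csi_II ::
    "('f::{field,finite} \<Rightarrow> 'e::{field,finite}) \<Rightarrow> nat \<Rightarrow> nat \<Rightarrow> ('f, 'e, 'q, 'a) protocol \<Rightarrow> bool" where
  "pir_csi_II \<iota> K M P \<longleftrightarrow> recoverability \<iota> K M P \<and> W_privacy K M P"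

text \<open>
  \<open>L / H(A | W \<in> S)\<close>, where $L = l \log_2 q$ is the size in bits of a message in $F_{q^l}$.
\<close>

definition rate ::
    "nat \<Rightarrow> nat \<Rightarrow> nat \<Rightarrow> nat \<Rightarrow> ('f::{field,finite}, 'e::{field,finite}, 'q, 'a) protocol \<Rightarrow> real" where
  "rate q l K M P =
     (real l * log 2 (real q)) / ent_given_event (model_II K M P) (rA P) {\<omega>. rInd \<omega> = 1}"

text \<open>
  For every query that can occur, the answer is a list of fixed combinations of the messages, with
  coefficients in the small field.
\<close>

definition scalar_linear ::
    "('f::{field,finite} \<Rightarrow> 'e::{field,finite}) \<Rightarrow> nat \<Rightarrow> nat \<Rightarrow> ('f, 'e, 'q, 'e list) protocol \<Rightarrow> bool" where
  "scalar_linear \<iota> K M P \<longleftrightarrow>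
     (\<forall>(Q, \<theta>) \<in> (\<lambda>\<omega>. (rQ \<omega>, rInd \<omega>)) ` set_pmf (model_II K M P).
        \<exists>vs :: (nat \<Rightarrow> 'f) list. \<forall>x \<in> message_vectors K.
          answer P Q \<theta> x = map (\<lambda>v. \<Sum>i\<in>indices K. \<iota> (v i) * x i) vs)"


section \<open>The Randomized Selection-and-Code protocols\<close>

text \<open>
  A query is the list of its components \<open>(U, V)\<close>: one component in Cases 1 and 4, an ordered pair
  in Cases 2 and 3.
\<close>

type_synonym 'f component = "nat list \<times> 'f list"

definition component_answer ::
    "('f::field \<Rightarrow> 'e::field) \<Rightarrow> (nat \<Rightarrow> 'e) \<Rightarrow> 'f component \<Rightarrow> 'e" where
  "component_answer \<iota> x = (\<lambda>(U, V). \<Sum>(u, b) \<leftarrow> zip U V. \<iota> b * x u)"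

definition rsc_answer ::
    "('f::field \<Rightarrow> 'e::field) \<Rightarrow> 'f component list \<Rightarrow> nat \<Rightarrow> (nat \<Rightarrow> 'e) \<Rightarrow> 'e list" where
  "rsc_answer \<iota> Q \<theta> x = map (component_answer \<iota> x) Q"

definition random_subset :: "nat \<Rightarrow> nat set \<Rightarrow> nat set pmf" where
  "random_subset n T = pmf_of_set (subsets_of_size n T)"

definition random_order :: "'b \<Rightarrow> 'b \<Rightarrow> 'b list pmf" where
  "random_order Q1 Q2 =
     map_pmf (\<lambda>swap. if swap then [Q2, Q1] else [Q1, Q2]) (bernoulli_pmf (1 / 2))"

definition rsc_query_1 ::
    "nat \<Rightarrow> nat \<Rightarrow> nat set \<Rightarrow> 'f::{field,finite} list \<Rightarrow> 'f component list pmf" where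
  "rsc_query_1 K W S C = do {
     own \<leftarrow> bernoulli_pmf (1 / real K);
     let i = (if own then W else the_elem (S - {W}));
     return_pmf [([i], [1])]
   }"

text \<open>
  Below, \<open>r = M - 2\<close> iff \<open>own\<close>. If the other value \<open>r = M - 1\<close> has probability 0, there may be no
  subset to choose, but then that branch is never taken. Likewise for \<open>s = 2M - K - 1\<close> iff \<open>own\<close>
  in Case 3.
\<close>

definition rsc_query_2 ::
    "nat \<Rightarrow> nat \<Rightarrow> nat \<Rightarrow> nat set \<Rightarrow> 'f::{field,finite} list \<Rightarrow> 'f component list pmf" where
  "rsc_query_2 K M W S C = do {
     own \<leftarrow> bernoulli_pmf ((2 * real M - 2) / real K);
     T \<leftarrow> (if own then map_pmf (insert W) (random_subset (M - 2) (indices K - S))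
           else random_subset (M - 1) (indices K - S));
     let U1 = sorted_list_of_set (S - {W});
     let U2 = sorted_list_of_set T;
     let V = map (coef S C) U1;
     random_order (U1, V) (U2, V)
   }"

definition rsc_query_3 ::
    "nat \<Rightarrow> nat \<Rightarrow> nat \<Rightarrow> nat set \<Rightarrow> 'f::{field,finite} list \<Rightarrow> 'f component list pmf" where
  "rsc_query_3 K M W S C = do {
     own \<leftarrow> bernoulli_pmf (1 - (2 * real K - 2 * real M) / real K);
     T \<leftarrow> (if own then map_pmf (insert W) (random_subset (2 * M - K - 1) (S - {W}))
           else random_subset (2 * M - K) (S - {W}));
     c \<leftarrow> pmf_of_set (UNIV - {0, coef S C W});
     let U1 = sorted_list_of_set S;
     let U2 = sorted_list_of_set (T \<union> (indices K - S));
     let V = map ((coef S C)(W := c)) U1;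
     random_order (U1, V) (U2, V)
   }"

definition rsc_query_4 ::
    "nat \<Rightarrow> nat \<Rightarrow> nat set \<Rightarrow> 'f::{field,finite} list \<Rightarrow> 'f component list pmf" where
  "rsc_query_4 K W S C = do {
     c \<leftarrow> pmf_of_set (UNIV - {0, coef S C W});
     let U = sorted_list_of_set (indices K);
     let V = map ((coef S C)(W := c)) U;
     return_pmf [(U, V)]
   }"

type_synonym ('f, 'e) rsc_protocol = "('f, 'e, 'f component list, 'e list) protocol"

definition rsc_1 ::
    "('f::{field,finite} \<Rightarrow> 'e::{field,finite}) \<Rightarrow> nat \<Rightarrow> ('f, 'e) rsc_protocol" where
  "rsc_1 \<iota> K = \<lparr>query = rsc_query_1 K, answer = rsc_answer \<iota>\<rparr>"

definition rsc_2 ::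
    "('f::{field,finite} \<Rightarrow> 'e::{field,finite}) \<Rightarrow> nat \<Rightarrow> nat \<Rightarrow> ('f, 'e) rsc_protocol" where
  "rsc_2 \<iota> K M = \<lparr>query = rsc_query_2 K M, answer = rsc_answer \<iota>\<rparr>"

definition rsc_3 ::
    "('f::{field,finite} \<Rightarrow> 'e::{field,finite}) \<Rightarrow> nat \<Rightarrow> nat \<Rightarrow> ('f, 'e) rsc_protocol" where
  "rsc_3 \<iota> K M = \<lparr>query = rsc_query_3 K M, answer = rsc_answer \<iota>\<rparr>"

definition rsc_4 ::
    "('f::{field,finite} \<Rightarrow> 'e::{field,finite}) \<Rightarrow> nat \<Rightarrow> ('f, 'e) rsc_protocol" where
  "rsc_4 \<iota> K = \<lparr>query = rsc_query_4 K, answer = rsc_answer \<iota>\<rparr>"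

end

theory Submission
  imports Defs
begin

text \<open>
  Privacy: let \<open>D\<^sub>w\<close> be the law of the query given \<open>W = w\<close>; it suffices that \<open>D\<^sub>w\<close> does not depend on
  \<open>w\<close>. Given \<open>W = w\<close>, the set \<open>S - {w}\<close> is uniform, and the coefficients that are sent are uniform
  and independent of all index sets, because the only coefficient tied to the demand is dropped or
  re-randomised. What remains is to compare, for fixed \<open>(U\<^sub>1, U\<^sub>2)\<close>, the probabilities of the pair in
  the two possible orders for the different positions of \<open>w\<close>; the selection probabilities of the
  protocols make them equal.

  Rate: each component of a query contains an index that occurs in no other component. Shifting the
  messages at these indices moves any answer to any other one, so the answer to every query is
  uniform.

  Recoverability: subtracting a component from the side information isolates the demanded message,
  whose coefficients in the two differ.
\<close>

section \<open>Information quantities of finite random variables\<close>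

text \<open>Given the demand, a two-component query is an index pair \<open>(A, B)\<close> in random
  order with a shared uniform \<open>V\<close>, so privacy concerns only the symmetrised law of
  \<open>(A, B)\<close>. In Case 2 the pairs are disjoint: a demand lying in one of the sets admits
  one order, a demand outside both admits two, so a decoy \<open>B\<close> containing
  \<open>W\<close> must weigh twice as much as one avoiding it. If \<open>p\<close> is the
  probability of including \<open>W\<close>, this reads
  \<open>p / binom(K-M, M-2) = 2 (1-p) / binom(K-M, M-1)\<close>, with solution
  \<open>p = (2M-2)/K\<close>. In Case 3 the pairs cover all indices: a demand in both sets admits
  two orders, a demand in one set only one, so the ratio is reversed, and
  \<open>(1-p) / binom(M-1, 2M-K) = 2 p / binom(M-1, 2M-K-1)\<close> gives
  \<open>p = (2M-K)/K\<close>. The bound \<open>q >= 3\<close> of Cases 3 and 4 leaves a nonzero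
  scalar to which the coefficient of the demand can be changed. Changing it to a uniform other value
  keeps it uniform, but the new value depends on the old one; hence the laws of the coefficients are
  computed with the entry of the demand split off.\<close>

lemma simple_distributed_outcome_space:
  assumes "finite (set_pmf p)"
  shows "simple_distributed (outcome_space p) X (pmf (map_pmf X p))"
proof -
  interpret information_space "outcome_space p" 2
    by (rule information_space_outcome_space)
  have "sets (outcome_space p) = Pow (set_pmf p)"
    by (auto simp: outcome_space_def sets_restrict_space)
  then have "simple_function (outcome_space p) X"
    using assms by (auto simp: simple_function_def)
  then show ?thesis
  proof (rule simple_distributedI)
    fix x
    have "measure (outcome_space p) (X -` {x} \<inter> set_pmf p) = measure p (X -` {x} \<inter> set_pmf p)"
      unfolding outcome_space_def by (rule measure_restrict_space) auto
    then show "pmf (map_pmf X p) x = measure (outcome_space p) (X -` {x} \<inter> space (outcome_space p))"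
      by (simp add: pmf_map measure_Int_set_pmf)
  qed simp
qed

lemma ent_uniform:
  assumes "finite (set_pmf p)" "map_pmf X p = pmf_of_set A" "finite A" "A \<noteq> {}"
  shows "ent p X = log 2 (real (card A))"
proof -
  interpret information_space "outcome_space p" 2
    by (rule information_space_outcome_space)
  have "X ` set_pmf p = A"
    using assms by (metis set_map_pmf set_pmf_of_set)
  then show ?thesis
    using entropy_simple_distributed[OF simple_distributed_outcome_space[OF assms(1), of X]] assms
    by (simp add: ent_def value_space_def log_divide)
qed

text \<open>If \<open>Y\<close> determines \<open>X\<close> on the support, then adding
  \<open>X\<close> to the observation of \<open>Y\<close> does not shrink the event, so each summand
  of the conditional entropy has logarithm 0. This turns recoverability into a statement about pairs
  of outcomes, without any posterior law.\<close>

lemma cond_ent_eq_0: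
  assumes fin: "finite (set_pmf p)"
    and det: "\<And>\<omega> \<omega>'. \<omega> \<in> set_pmf p \<Longrightarrow> \<omega>' \<in> set_pmf p \<Longrightarrow> Y \<omega> = Y \<omega>' \<Longrightarrow> X \<omega> = X \<omega>'"
  shows "cond_ent p X Y = 0"
proof -
  interpret information_space "outcome_space p" 2
    by (rule information_space_outcome_space)
  have *: "pmf (map_pmf (\<lambda>x. (X x, Y x)) p) (X \<omega>, Y \<omega>) = pmf (map_pmf Y p) (Y \<omega>)"
    if "\<omega> \<in> set_pmf p" for \<omega>
  proof -
    have "(\<lambda>x. (X x, Y x)) -` {(X \<omega>, Y \<omega>)} \<inter> set_pmf p = Y -` {Y \<omega>} \<inter> set_pmf p"
      using det that by blast
    then show ?thesis
      unfolding pmf_map by (metis measure_Int_set_pmf)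
  qed
  show ?thesis
    using conditional_entropy_eq[OF simple_distributed_outcome_space[OF fin, of Y]
        simple_distributed_outcome_space[OF fin, of "\<lambda>x. (X x, Y x)"]]
    unfolding cond_ent_def value_space_def
    by (auto intro!: sum.neutral simp: *)
qed

text \<open>A constant \<open>Z\<close> drops out of all joint laws, and by independence each
  summand is then a multiple of \<open>log 2 1\<close>. It is meant for the indicator of
  \<open>W \<in> S\<close>, which is constantly 1 under Model II.\<close>

lemma cond_mutual_inf_eq_0:
  assumes fin: "finite (set_pmf p)"
    and indep: "map_pmf (\<lambda>\<omega>. (X \<omega>, Y \<omega>)) p = pair_pmf (map_pmf X p) (map_pmf Y p)"
    and const: "\<And>\<omega>. \<omega> \<in> set_pmf p \<Longrightarrow> Z \<omega> = z"
  shows "cond_mutual_inf p X Y Z = 0"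
proof -
  interpret information_space "outcome_space p" 2
    by (rule information_space_outcome_space)
  note sd = simple_distributed_outcome_space[OF fin]
  have pz: "pmf (map_pmf Z p) z = 1"
    using const by (subst map_pmf_cong[OF refl, of _ _ "\<lambda>_. z"]) (auto simp: map_pmf_const)
  have drop: "pmf (map_pmf (\<lambda>x. (f x, Z x)) p) (a, z) = pmf (map_pmf f p) a" for f :: "'a \<Rightarrow> 'x" and a
  proof -
    have "map_pmf (\<lambda>x. (f x, Z x)) p = map_pmf (\<lambda>a. (a, z)) (map_pmf f p)"
      using const by (auto simp: pmf.map_comp intro!: map_pmf_cong)
    then show ?thesis
      by (simp only:) (rule pmf_map_inj', auto simp: inj_def)
  qed
  have drop3: "pmf (map_pmf (\<lambda>x. (X x, Y x, Z x)) p) (a, b, z)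
      = pmf (map_pmf X p) a * pmf (map_pmf Y p) b" for a b
  proof -
    have "map_pmf (\<lambda>x. (X x, Y x, Z x)) p = map_pmf (\<lambda>(a, b). (a, b, z)) (map_pmf (\<lambda>x. (X x, Y x)) p)"
      using const by (auto simp: pmf.map_comp intro!: map_pmf_cong)
    moreover have "pmf (map_pmf (\<lambda>(a, b). (a, b, z)) (map_pmf (\<lambda>x. (X x, Y x)) p))
        ((\<lambda>(a, b). (a, b, z)) (a, b)) = pmf (map_pmf (\<lambda>x. (X x, Y x)) p) (a, b)"
      by (rule pmf_map_inj') (auto simp: inj_def)
    ultimately show ?thesis
      by (simp add: indep pmf_pair)
  qed
  have "conditional_mutual_information 2 (count_space (X ` space (outcome_space p)))
      (count_space (Y ` space (outcome_space p))) (count_space (Z ` space (outcome_space p))) X Y Z = 0"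
    unfolding conditional_mutual_information_eq[OF sd sd sd sd]
  proof (intro sum.neutral ballI)
    fix v assume "v \<in> (\<lambda>x. (X x, Y x, Z x)) ` space (outcome_space p)"
    then obtain \<omega> where \<omega>: "\<omega> \<in> set_pmf p" and v: "v = (X \<omega>, Y \<omega>, z)"
      using const by auto
    \<comment> \<open>Positive marginals let the quotient under the logarithm cancel to 1.\<close>
    have "pmf (map_pmf X p) (X \<omega>) > 0" "pmf (map_pmf Y p) (Y \<omega>) > 0"
      using \<omega> by (auto simp: pmf_positive_iff)
    then show "(case v of (x, y, z) \<Rightarrow> pmf (map_pmf (\<lambda>x. (X x, Y x, Z x)) p) (x, y, z) *
        log 2 (pmf (map_pmf (\<lambda>x. (X x, Y x, Z x)) p) (x, y, z) /
          (pmf (map_pmf (\<lambda>x. (X x, Z x)) p) (x, z) *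
            (pmf (map_pmf (\<lambda>x. (Y x, Z x)) p) (y, z) / pmf (map_pmf Z p) z)))) = 0"
      by (simp add: v drop drop3 pz)
  qed
  then show ?thesis
    by (simp add: cond_mutual_inf_def value_space_def)
qed

section \<open>The joint distribution\<close>

lemma finite_indices [simp]: "finite (indices K)"
  and card_indices [simp]: "card (indices K) = K"
  by (simp_all add: indices_def)

lemma finite_subsets_of_size [simp]: "finite T \<Longrightarrow> finite (subsets_of_size n T)"
  by (simp add: subsets_of_size_def)

lemma card_subsets_of_size [simp]: "finite T \<Longrightarrow> card (subsets_of_size n T) = card T choose n"
  by (simp add: subsets_of_size_def n_subsets)

lemma subsets_of_size_nonempty [simp]: "finite T \<Longrightarrow> n \<le> card T \<Longrightarrow> subsets_of_size n T \<noteq> {}"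
  unfolding subsets_of_size_def by (auto elim: obtain_subset_with_card_n)

lemma subsets_of_size_finite_nonempty:
  assumes "S \<in> subsets_of_size M (indices K)" "1 \<le> M"
  shows "finite S \<and> S \<noteq> {}"
proof
  have "S \<subseteq> indices K" using assms(1) by (simp add: subsets_of_size_def)
  then show "finite S" by (rule finite_subset) simp
  show "S \<noteq> {}" using assms by (auto simp: subsets_of_size_def)
qed

lemma set_random_subset [simp]:
  "finite T \<Longrightarrow> n \<le> card T \<Longrightarrow> set_pmf (random_subset n T) = subsets_of_size n T"
  by (simp add: random_subset_def)

lemma pmf_random_subset:
  "finite T \<Longrightarrow> n \<le> card T \<Longrightarrow>
    pmf (random_subset n T) B = (if B \<subseteq> T \<and> card B = n then 1 / (card T choose n) else 0)"
  by (simp add: random_subset_def pmf_of_set indicator_def) (simp add: subsets_of_size_def)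

lemma finite_coeff_seqs [simp]: "finite (coeff_seqs M :: 'f::{field,finite} list set)"
  by (rule finite_subset[OF _ finite_lists_length_eq[of UNIV M]]) (auto simp: coeff_seqs_def)

lemma coeff_seqs_nonempty [simp]: "(coeff_seqs M :: 'f::field list set) \<noteq> {}"
proof -
  have "replicate M 1 \<in> (coeff_seqs M :: 'f list set)"
    by (auto simp: coeff_seqs_def)
  then show ?thesis by blast
qed

lemma finite_message_vectors [simp]: "finite (message_vectors K :: (nat \<Rightarrow> 'e::{field,finite}) set)"
  by (simp add: message_vectors_def finite_PiE)

lemma message_vectors_nonempty [simp]: "(message_vectors K :: (nat \<Rightarrow> 'e::field) set) \<noteq> {}"
  by (simp add: message_vectors_def PiE_eq_empty_iff)

text \<open>Injectivity of \<open>f\<close> is needed only at the single value \<open>y\<close>, and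
  only on the support. The point \<open>t\<close> may itself lie outside the support; then both
  sides are 0.\<close>

lemma pmf_map_eq:
  assumes "\<And>x. x \<in> set_pmf p \<Longrightarrow> f x = y \<longleftrightarrow> x = t"
  shows "pmf (map_pmf f p) y = pmf p t"
proof -
  have "f -` {y} \<inter> set_pmf p = {t} \<inter> set_pmf p"
    using assms by auto
  then show ?thesis
    unfolding pmf_map by (metis measure_Int_set_pmf measure_pmf_single)
qed

lemma pmf_map_eq_0:
  assumes "\<And>x. x \<in> set_pmf p \<Longrightarrow> f x \<noteq> y"
  shows "pmf (map_pmf f p) y = 0"
  using assms by (auto simp: pmf_eq_0_set_pmf)

text \<open>As \<open>w\<close> lies outside \<open>T\<close>, insertion is undone by removal: the
  only candidate mapped to \<open>B\<close> is \<open>B - {w}\<close>.\<close>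

lemma pmf_insert_random_subset:
  assumes "finite T" "n \<le> card T" "w \<notin> T"
  shows "pmf (map_pmf (insert w) (random_subset n T)) B =
    (if w \<in> B \<and> B \<subseteq> insert w T \<and> card B = Suc n then 1 / (card T choose n) else 0)"
proof (cases "w \<in> B")
  case True
  then have "pmf (map_pmf (insert w) (random_subset n T)) B = pmf (random_subset n T) (B - {w})"
    using assms by (intro pmf_map_eq) (auto simp: subsets_of_size_def)
  also have "\<dots> = (if B - {w} \<subseteq> T \<and> card (B - {w}) = n then 1 / (card T choose n) else 0)"
    using assms(1,2) by (rule pmf_random_subset)
  moreover have "card B = Suc (card (B - {w}))" if "B \<subseteq> insert w T"
    by (rule card.remove[OF finite_subset[OF that] True]) (simp add: assms(1))
  moreover have "B - {w} \<subseteq> T \<longleftrightarrow> B \<subseteq> insert w T"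
    by blast
  ultimately show ?thesis using True by auto
next
  case False
  then show ?thesis by (auto intro: pmf_map_eq_0)
qed

text \<open>Chain rule: since the first draw is kept in the result, no sum over it remains.\<close>

lemma pmf_bind_pair:
  "pmf (p \<bind> (\<lambda>x. map_pmf (Pair x) (f x))) (a, b) = pmf p a * pmf (f a) b"
proof -
  have *: "pmf (map_pmf (Pair x) (f x)) (a, b) = indicator {a} x * pmf (f a) b" for x
  proof (cases "x = a")
    case True
    then show ?thesis by (simp add: pmf_map_inj'[of "Pair a"] inj_def)
  next
    case False
    then have "(a, b) \<notin> set_pmf (map_pmf (Pair x) (f x))" by auto
    with False show ?thesis unfolding pmf_eq_0_set_pmf[symmetric] by simp
  qed
  show ?thesis
    by (simp add: pmf_bind * measure_pmf_single)
qed

text \<open>Both procedures are uniform on the pairs of an \<open>M\<close>-subset and one of its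
  elements; the two normalisations agree by \<open>M * binom(n, M) = n * binom(n-1, M-1)\<close>.
  Drawing the demand first is what makes conditioning on it possible.\<close>

lemma uniform_subset_element_swap:
  assumes "finite I" "1 \<le> M" "M \<le> card I"
  shows "do {S \<leftarrow> pmf_of_set (subsets_of_size M I); W \<leftarrow> pmf_of_set S; return_pmf (W, S)} =
         do {W \<leftarrow> pmf_of_set I; A \<leftarrow> random_subset (M - 1) (I - {W}); return_pmf (W, insert W A)}"
    (is "?L = ?R")
proof (rule pmf_eqI, clarify)
  fix w s
  have "card I > 0" "I \<noteq> {}" using assms by auto
  have L: "?L = map_pmf prod.swap (random_subset M I \<bind> (\<lambda>S. map_pmf (Pair S) (pmf_of_set S)))"
    by (simp add: random_subset_def map_bind_pmf map_pmf_def bind_assoc_pmf bind_return_pmf)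
  have "pmf ?L (prod.swap (s, w)) = pmf (random_subset M I) s * pmf (pmf_of_set s) w"
    unfolding L by (subst pmf_map_inj') (auto simp: pmf_bind_pair)
  also have "\<dots> = (if s \<subseteq> I \<and> card s = M \<and> w \<in> s then 1 / (card I choose M) * (1 / M) else 0)"
  proof (cases "s \<subseteq> I \<and> card s = M")
    case True
    then have "finite s" "s \<noteq> {}" using assms finite_subset[of s I] by auto
    with True assms show ?thesis by (auto simp: pmf_random_subset pmf_of_set)
  qed (use assms in \<open>auto simp: pmf_random_subset\<close>)
  also have "\<dots> = (if s \<subseteq> I \<and> card s = M \<and> w \<in> s then 1 / card I * (1 / (card I - 1 choose (M - 1))) else 0)"
  proof -
    have "M * (card I choose M) = card I * (card I - 1 choose (M - 1))"
      using assms Suc_times_binomial_eq[of "card I - 1" "M - 1"] \<open>card I > 0\<close>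
      by (simp add: mult.commute)
    then have "real M * real (card I choose M) = real (card I) * real (card I - 1 choose (M - 1))"
      by (metis of_nat_mult)
    then show ?thesis by (simp add: mult.commute)
  qed
  also have "\<dots> = pmf (pmf_of_set I) w * pmf (map_pmf (insert w) (random_subset (M - 1) (I - {w}))) s"
  proof (cases "w \<in> I")
    case True
    then have "pmf (map_pmf (insert w) (random_subset (M - 1) (I - {w}))) s =
        (if w \<in> s \<and> s \<subseteq> I \<and> card s = M then 1 / (card I - 1 choose (M - 1)) else 0)"
      using assms by (subst pmf_insert_random_subset) (auto simp: insert_absorb)
    then show ?thesis
      using assms(1) True \<open>I \<noteq> {}\<close> by auto
  qed (use assms \<open>I \<noteq> {}\<close> in auto)
  also have "\<dots> = pmf (pmf_of_set I \<bind> (\<lambda>w. map_pmf (Pair w)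
      (map_pmf (insert w) (random_subset (M - 1) (I - {w}))))) (w, s)"
    by (simp add: pmf_bind_pair)
  also have "pmf_of_set I \<bind> (\<lambda>w. map_pmf (Pair w)
      (map_pmf (insert w) (random_subset (M - 1) (I - {w})))) = ?R"
    by (simp add: map_pmf_def bind_assoc_pmf bind_return_pmf)
  finally show "pmf ?L (w, s) = pmf ?R (w, s)" by simp
qed

text \<open>The conditional law \<open>D\<^sub>w\<close> of the query: \<open>A\<close> stands for
  \<open>S - {W}\<close>, and the messages are absent because the query does not see them.\<close>

definition query_law :: "nat \<Rightarrow> nat \<Rightarrow> ('f::{field,finite}, 'e::{field,finite}, 'q, 'a) protocol \<Rightarrow> nat \<Rightarrow> 'q pmf"
  where "query_law K M P W = do {
     A \<leftarrow> random_subset (M - 1) (indices K - {W});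
     C \<leftarrow> pmf_of_set (coeff_seqs M);
     query P W (insert W A) C
   }"

lemma set_model_II:
  assumes "1 \<le> M" "M \<le> K" "\<omega> \<in> set_pmf (model_II K M P)"
  shows "rS \<omega> \<subseteq> indices K" "card (rS \<omega>) = M" "rW \<omega> \<in> rS \<omega>" "rC \<omega> \<in> coeff_seqs M"
    "rX \<omega> \<in> message_vectors K" "rQ \<omega> \<in> set_pmf (query P (rW \<omega>) (rS \<omega>) (rC \<omega>))" "rInd \<omega> = 1"
proof -
  have *: "finite S \<and> S \<noteq> {}" if "S \<in> subsets_of_size M (indices K)" for S
    using that assms(1) by (rule subsets_of_size_finite_nonempty)
  have "rS \<omega> \<in> subsets_of_size M (indices K) \<and> rW \<omega> \<in> rS \<omega> \<and> rC \<omega> \<in> coeff_seqs M \<and>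
    rX \<omega> \<in> message_vectors K \<and> rQ \<omega> \<in> set_pmf (query P (rW \<omega>) (rS \<omega>) (rC \<omega>))"
    using assms * by (auto simp: model_II_def)
  then show "rS \<omega> \<subseteq> indices K" "card (rS \<omega>) = M" "rW \<omega> \<in> rS \<omega>" "rC \<omega> \<in> coeff_seqs M"
    "rX \<omega> \<in> message_vectors K" "rQ \<omega> \<in> set_pmf (query P (rW \<omega>) (rS \<omega>) (rC \<omega>))" "rInd \<omega> = 1"
    by (auto simp: subsets_of_size_def rInd_def)
qed

text \<open>All ingredients other than the query range over finite sets by themselves. The type of
  queries may be infinite, so a finite set \<open>F\<close> of possible queries has to be
  supplied.\<close>

lemma finite_set_model_II:
  fixes P :: "('f::{field,finite}, 'e::{field,finite}, 'q, 'a) protocol"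
  assumes "1 \<le> M" "M \<le> K" "finite F"
    and "\<And>W S C. W \<in> S \<Longrightarrow> S \<subseteq> indices K \<Longrightarrow> card S = M \<Longrightarrow> C \<in> coeff_seqs M \<Longrightarrow>
      set_pmf (query P W S C) \<subseteq> F"
  shows "finite (set_pmf (model_II K M P))"
proof (rule finite_subset)
  let ?T = "indices K \<times> Pow (indices K) \<times> (coeff_seqs M :: 'f list set) \<times>
    (message_vectors K :: (nat \<Rightarrow> 'e) set) \<times> F"
  show "set_pmf (model_II K M P) \<subseteq> (\<lambda>(W, S, C, x, Q). \<lparr>rW = W, rS = S, rC = C, rX = x, rQ = Q\<rparr>) ` ?T"
  proof
    fix \<omega> assume "\<omega> \<in> set_pmf (model_II K M P)"
    note * = set_model_II[OF assms(1,2) this]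
    show "\<omega> \<in> (\<lambda>(W, S, C, x, Q). \<lparr>rW = W, rS = S, rC = C, rX = x, rQ = Q\<rparr>) ` ?T"
    proof (rule image_eqI[of _ _ "(rW \<omega>, rS \<omega>, rC \<omega>, rX \<omega>, rQ \<omega>)"])
      show "(rW \<omega>, rS \<omega>, rC \<omega>, rX \<omega>, rQ \<omega>) \<in> ?T"
        using *(1-6) assms(4)[OF *(3,1,2,4)] by blast
    qed simp
  qed
  show "finite ((\<lambda>(W, S, C, x, Q). \<lparr>rW = W, rS = S, rC = C, rX = x, rQ = Q\<rparr>) ` ?T)"
    using assms(3) by (intro finite_imageI finite_cartesian_product) auto
qed

lemma demand_query_law:
  assumes "1 \<le> M" "M \<le> K"
  shows "map_pmf (\<lambda>\<omega>. (rW \<omega>, rQ \<omega>)) (model_II K M P) =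
    pmf_of_set (indices K) \<bind> (\<lambda>W. map_pmf (Pair W) (query_law K M P W))"
proof -
  let ?g = "\<lambda>(W, S). pmf_of_set (coeff_seqs M) \<bind> (\<lambda>C. map_pmf (Pair W) (query P W S C))"
  have "map_pmf (\<lambda>\<omega>. (rW \<omega>, rQ \<omega>)) (model_II K M P) =
    do {S \<leftarrow> pmf_of_set (subsets_of_size M (indices K)); W \<leftarrow> pmf_of_set S; return_pmf (W, S)} \<bind> ?g"
    by (simp add: model_II_def map_pmf_def bind_assoc_pmf bind_return_pmf)
  also have "\<dots> = do {W \<leftarrow> pmf_of_set (indices K);
      A \<leftarrow> random_subset (M - 1) (indices K - {W}); return_pmf (W, insert W A)} \<bind> ?g"
    using assms by (subst uniform_subset_element_swap) auto
  also have "\<dots> = pmf_of_set (indices K) \<bind> (\<lambda>W. map_pmf (Pair W) (query_law K M P W))"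
    by (simp add: query_law_def map_pmf_def bind_assoc_pmf bind_return_pmf)
  finally show ?thesis .
qed

text \<open>A kernel that does not depend on the demand makes the joint law of demand and query a
  product; its two marginals are then read off by projection.\<close>

lemma W_privacy_if_query_law_constant:
  assumes "1 \<le> M" "M \<le> K" "finite (set_pmf (model_II K M P))"
    and "\<And>W. W \<in> indices K \<Longrightarrow> query_law K M P W = D"
  shows "W_privacy K M P"
proof -
  have "indices K \<noteq> {}" using assms by (auto simp: indices_def)
  then have "map_pmf (\<lambda>\<omega>. (rW \<omega>, rQ \<omega>)) (model_II K M P) = pair_pmf (pmf_of_set (indices K)) D"
    using assms(4) unfolding demand_query_law[OF assms(1,2)] pair_pmf_def
    by (intro bind_pmf_cong) (simp_all add: map_pmf_def)
  moreover from arg_cong[OF this, of "map_pmf fst"] arg_cong[OF this, of "map_pmf snd"]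
  have "map_pmf rW (model_II K M P) = pmf_of_set (indices K)" "map_pmf rQ (model_II K M P) = D"
    by (simp_all add: pmf.map_comp o_def map_fst_pair_pmf map_snd_pair_pmf)
  ultimately show ?thesis
    using assms set_model_II(7)[OF assms(1,2)] unfolding W_privacy_def
    by (intro cond_mutual_inf_eq_0) auto
qed

text \<open>The messages are independent of the query, so they can be drawn after it. The answer law
  is then a mixture of laws that all equal \<open>U\<close>, whatever the law of the query.\<close>

lemma answer_law:
  assumes "1 \<le> M" "M \<le> K"
    and ans: "\<And>W S C Q. W \<in> S \<Longrightarrow> S \<subseteq> indices K \<Longrightarrow> card S = M \<Longrightarrow> C \<in> coeff_seqs M \<Longrightarrow>
      Q \<in> set_pmf (query P W S C) \<Longrightarrow> map_pmf (answer P Q 1) (pmf_of_set (message_vectors K)) = U"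
  shows "map_pmf (rA P) (model_II K M P) = U"
proof -
  have *: "finite S \<and> S \<noteq> {}" if "S \<in> subsets_of_size M (indices K)" for S
    using that assms(1) by (rule subsets_of_size_finite_nonempty)
  have commute: "do {
      x \<leftarrow> pmf_of_set (message_vectors K);
      Q \<leftarrow> query P W S C;
      return_pmf (answer P Q (of_bool (W \<in> S)) x)
    } = do {
      Q \<leftarrow> query P W S C;
      x \<leftarrow> pmf_of_set (message_vectors K);
      return_pmf (answer P Q (of_bool (W \<in> S)) x)
    }" for W S C
    by (rule bind_commute_pmf)
  have "map_pmf (rA P) (model_II K M P) = do {
     S \<leftarrow> pmf_of_set (subsets_of_size M (indices K));
     W \<leftarrow> pmf_of_set S;
     C \<leftarrow> pmf_of_set (coeff_seqs M);
     x \<leftarrow> pmf_of_set (message_vectors K);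
     Q \<leftarrow> query P W S C;
     return_pmf (answer P Q (of_bool (W \<in> S)) x)
   }"
    by (simp add: model_II_def map_pmf_def bind_assoc_pmf bind_return_pmf rA_def rInd_def)
  also have "\<dots> = do {
     S \<leftarrow> pmf_of_set (subsets_of_size M (indices K));
     W \<leftarrow> pmf_of_set S;
     C \<leftarrow> pmf_of_set (coeff_seqs M);
     Q \<leftarrow> query P W S C;
     x \<leftarrow> pmf_of_set (message_vectors K);
     return_pmf (answer P Q (of_bool (W \<in> S)) x)
   }"
    by (simp only: commute)
  also have "\<dots> = do {
     S \<leftarrow> pmf_of_set (subsets_of_size M (indices K));
     W \<leftarrow> pmf_of_set S;
     C \<leftarrow> pmf_of_set (coeff_seqs M);
     Q \<leftarrow> query P W S C;
     U
   }"
  proof (rule bind_pmf_cong[OF refl], rule bind_pmf_cong[OF refl], rule bind_pmf_cong[OF refl],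
      rule bind_pmf_cong[OF refl])
    fix S W C Q
    assume a: "S \<in> set_pmf (pmf_of_set (subsets_of_size M (indices K)))" "W \<in> set_pmf (pmf_of_set S)"
      "C \<in> set_pmf (pmf_of_set (coeff_seqs M))" "Q \<in> set_pmf (query P W S C)"
    from a(1) have S: "S \<in> subsets_of_size M (indices K)" using assms by simp
    from a(2) have W: "W \<in> S" using *[OF S] by simp
    from a(3) have C: "C \<in> coeff_seqs M" by simp
    show "pmf_of_set (message_vectors K) \<bind> (\<lambda>x. return_pmf (answer P Q (of_bool (W \<in> S)) x)) = U"
      using ans[OF W _ _ C a(4)] S W by (simp add: map_pmf_def subsets_of_size_def)
  qed
  finally show ?thesis by simp
qed

text \<open>Query, demand, side-information set and coefficients are all part of the condition, so
  two outcomes that agree on it can differ only in their messages.\<close>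

lemma recoverability_if_decodable:
  assumes "1 \<le> M" "M \<le> K" "finite (set_pmf (model_II K M P))"
    and "\<And>W S C Q x x'. W \<in> S \<Longrightarrow> S \<subseteq> indices K \<Longrightarrow> card S = M \<Longrightarrow> C \<in> coeff_seqs M \<Longrightarrow>
      Q \<in> set_pmf (query P W S C) \<Longrightarrow> answer P Q 1 x = answer P Q 1 x' \<Longrightarrow>
      side_info \<iota> S C x = side_info \<iota> S C x' \<Longrightarrow> x W = x' W"
  shows "recoverability \<iota> K M P"
  unfolding recoverability_def
proof (rule cond_ent_eq_0[OF assms(3)])
  fix \<omega> \<omega>'
  assume "\<omega> \<in> set_pmf (model_II K M P)" and \<omega>': "\<omega>' \<in> set_pmf (model_II K M P)"
    and eq: "(rA P \<omega>, rQ \<omega>, rInd \<omega>, rY \<iota> \<omega>, rW \<omega>, rS \<omega>, rC \<omega>) =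
      (rA P \<omega>', rQ \<omega>', rInd \<omega>', rY \<iota> \<omega>', rW \<omega>', rS \<omega>', rC \<omega>')"
  note * = set_model_II[OF assms(1,2) this(1)]
  show "rX \<omega> (rW \<omega>) = rX \<omega>' (rW \<omega>')"
  proof -
    have "rA P \<omega> = rA P \<omega>'" "rQ \<omega>' = rQ \<omega>"
      using eq unfolding prod.inject by simp_all
    then have "answer P (rQ \<omega>) 1 (rX \<omega>) = answer P (rQ \<omega>) 1 (rX \<omega>')"
      unfolding rA_def *(7) set_model_II(7)[OF assms(1,2) \<omega>'] by metis
    moreover have "side_info \<iota> (rS \<omega>) (rC \<omega>) (rX \<omega>) = side_info \<iota> (rS \<omega>) (rC \<omega>) (rX \<omega>')"
      using eq unfolding prod.inject rY_def by metis
    ultimately show ?thesis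
      using assms(4)[OF *(3,1,2,4,6)] eq by simp
  qed
qed

lemma rate_uniform_answer:
  assumes "1 \<le> M" "M \<le> K" "finite (set_pmf (model_II K M P))"
    and "map_pmf (rA P) (model_II K M P) = pmf_of_set U" "card U = (q ^ l) ^ n"
    and "1 \<le> l" "2 \<le> q"
  shows "rate q l K M P = 1 / real n"
proof -
  let ?p = "model_II K M P" and ?E = "{\<omega>::('a, 'b, 'c) outcome. rInd \<omega> = 1}"
  have E: "set_pmf ?p \<subseteq> ?E"
    using set_model_II(7)[OF assms(1,2)] by auto
  then have *: "set_pmf ?p \<inter> ?E \<noteq> {}"
    using set_pmf_not_empty[of ?p] by blast
  have "measure ?p ?E = 1"
    using E by (simp add: measure_pmf.prob_eq_1 AE_measure_pmf_iff subset_eq)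
  \<comment> \<open>The indicator is 1 almost surely, so conditioning on it changes nothing.\<close>
  then have "cond_pmf ?p ?E = ?p"
    using E by (intro pmf_eqI) (auto simp: pmf_cond[OF *] pmf_eq_0_set_pmf simp del: One_nat_def)
  moreover have "card U > 0"
    using assms by simp
  then have "ent ?p (rA P) = log 2 (card U)"
    using assms(3,4) by (intro ent_uniform) (simp_all add: card_gt_0_iff)
  moreover have "\<dots> = real n * (real l * log 2 q)"
    using assms by (simp add: log_nat_power)
  moreover have "log 2 (real q) > 0"
    using assms(7) by simp
  then have "real l * log 2 q \<noteq> 0"
    using assms(6) by simp
  ultimately show ?thesis
    by (simp add: rate_def ent_given_event_def)
qed

section \<open>Answers to well-formed queries\<close>

lemma field_embedding_0: "field_embedding \<iota> \<Longrightarrow> \<iota> 0 = 0"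
  by (metis add_cancel_right_right field_embedding_def)

lemma field_embedding_eq_0_iff:
  assumes "field_embedding \<iota>"
  shows "\<iota> a = 0 \<longleftrightarrow> a = 0"
proof
  assume "\<iota> a = 0"
  have "\<iota> (a * inverse a) = \<iota> a * \<iota> (inverse a)"
    using assms by (simp add: field_embedding_def)
  then show "a = 0"
    using assms \<open>\<iota> a = 0\<close> by (cases "a = 0") (auto simp: field_embedding_def)
qed (use assms field_embedding_0 in auto)

text \<open>The map \<open>g\<close> embeds the fibre of \<open>f\<close> over \<open>y\<close> into
  the fibre over \<open>y'\<close>. As \<open>y\<close> and \<open>y'\<close> can be exchanged, all
  fibres have the same size, and double counting gives that size. A separate \<open>g\<close> for
  each pair is allowed.\<close>

lemma map_pmf_of_set_uniform:
  assumes "finite X" "X \<noteq> {}" "finite Y" "Y \<noteq> {}" "f ` X \<subseteq> Y"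
    and shift: "\<And>y y'. y \<in> Y \<Longrightarrow> y' \<in> Y \<Longrightarrow>
      \<exists>g. inj_on g X \<and> (\<forall>x\<in>X. g x \<in> X \<and> (f x = y \<longrightarrow> f (g x) = y'))"
  shows "map_pmf f (pmf_of_set X) = pmf_of_set Y"
proof (rule pmf_eqI)
  fix y
  let ?N = "\<lambda>y. card {x \<in> X. f x = y}"
  have le: "?N y \<le> ?N y'" if yY: "y \<in> Y" "y' \<in> Y" for y y'
  proof -
    obtain g where g: "inj_on g X" "\<And>x. x \<in> X \<Longrightarrow> g x \<in> X \<and> (f x = y \<longrightarrow> f (g x) = y')"
      using shift[OF yY] by blast
    show ?thesis
      by (rule card_inj_on_le[of g]) (use g assms(1) in \<open>auto intro: inj_on_subset\<close>)
  qed
  have pmf: "pmf (map_pmf f (pmf_of_set X)) y = real (?N y) / real (card X)"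
    using assms by (simp add: pmf_map measure_pmf_of_set vimage_def Int_def)
  show "pmf (map_pmf f (pmf_of_set X)) y = pmf (pmf_of_set Y) y"
  proof (cases "y \<in> Y")
    case True
    have "card X = (\<Sum>y'\<in>Y. ?N y')"
      using assms by (subst sum_multicount_gen[of Y X "\<lambda>y x. f x = y" "\<lambda>_. 1"]) (auto simp: card_1_singleton_iff)
    also have "\<dots> = (\<Sum>y'\<in>Y. ?N y)"
      by (rule sum.cong[OF refl], rule le_antisym) (use le True in auto)
    also have "\<dots> = card Y * ?N y"
      by simp
    finally have *: "card X = card Y * ?N y" .
    moreover have "card X > 0"
      using assms by auto
    ultimately have "?N y > 0"
      by (metis gr0I mult_0_right less_irrefl)
    then show ?thesis
      using True assms(3,4) unfolding pmf * by (simp del: card_gt_0_iff)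
  next
    case False
    then have "{x \<in> X. f x = y} = {}" using assms(5) by auto
    then show ?thesis
      using False assms unfolding pmf by simp
  qed
qed

definition valid_component :: "nat \<Rightarrow> 'f::field component \<Rightarrow> bool" where
  "valid_component K = (\<lambda>(U, V). distinct U \<and> set U \<subseteq> indices K \<and> length V = length U \<and> 0 \<notin> set V)"

text \<open>A private index for every component: a combinatorial certificate of linear independence
  that works for all nonzero coefficients and is insensitive to the order of the components.\<close>

definition separated :: "'f component list \<Rightarrow> bool" where
  "separated Q \<longleftrightarrow> (\<forall>k<length Q. \<exists>i\<in>set (fst (Q ! k)). \<forall>k'<length Q. k' \<noteq> k \<longrightarrow> i \<notin> set (fst (Q ! k')))"

definition valid_query :: "nat \<Rightarrow> nat \<Rightarrow> 'f::field component list \<Rightarrow> bool" where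
  "valid_query K n Q \<longleftrightarrow> length Q = n \<and> (\<forall>c\<in>set Q. valid_component K c) \<and> separated Q"

text \<open>The exact support of \<open>v\<close> matters later: a nonzero value at the private
  index of a component allows division, and zeros keep the other components unaffected. Distinctness
  of \<open>U\<close> is what prevents a coefficient from being overwritten in the
  induction.\<close>

lemma component_answer_linear:
  assumes "field_embedding \<iota>" "valid_component K c"
  shows "\<exists>v. (\<forall>i. v i = 0 \<longleftrightarrow> i \<notin> set (fst c)) \<and>
    (\<forall>x. component_answer \<iota> x c = (\<Sum>i\<in>indices K. \<iota> (v i) * x i))"
proof -
  have "\<exists>v. (\<forall>i. v i = 0 \<longleftrightarrow> i \<notin> set U) \<and>
    (\<forall>x. component_answer \<iota> x (U, V) = (\<Sum>i\<in>indices K. \<iota> (v i) * x i))"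
    if "length U = length V" "distinct U" "set U \<subseteq> indices K" "0 \<notin> set V" for U V
    using that
  proof (induction U V rule: list_induct2)
    case Nil
    show ?case
      by (rule exI[of _ "\<lambda>_. 0"]) (simp add: component_answer_def field_embedding_0[OF assms(1)])
  next
    case (Cons u U b V)
    then obtain v where v: "\<And>i. v i = 0 \<longleftrightarrow> i \<notin> set U"
      "\<And>x. component_answer \<iota> x (U, V) = (\<Sum>i\<in>indices K. \<iota> (v i) * x i)"
      by auto
    have "component_answer \<iota> x (u # U, b # V) = (\<Sum>i\<in>indices K. \<iota> ((v(u := b)) i) * x i)" for x
    proof -
      have "v u = 0" "u \<in> indices K" using v(1) Cons.prems by auto
      have "component_answer \<iota> x (u # U, b # V) = \<iota> b * x u + component_answer \<iota> x (U, V)"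
        by (simp add: component_answer_def)
      also have "component_answer \<iota> x (U, V) = (\<Sum>i\<in>indices K - {u}. \<iota> (v i) * x i)"
        using \<open>u \<in> indices K\<close> \<open>v u = 0\<close> field_embedding_0[OF assms(1)]
        unfolding v(2) by (subst sum.remove[of _ u]) simp_all
      also have "\<iota> b * x u + \<dots> = (\<Sum>i\<in>indices K. \<iota> ((v(u := b)) i) * x i)"
        using \<open>u \<in> indices K\<close> by (subst (2) sum.remove[of _ u]) simp_all
      finally show ?thesis .
    qed
    moreover have "(v(u := b)) i = 0 \<longleftrightarrow> i \<notin> set (u # U)" for i
      using v(1) Cons.prems by auto
    ultimately show ?case by blast
  qed
  from this[of "fst c" "snd c"] show ?thesis
    using assms(2) by (auto simp: valid_component_def split_beta)
qed

lemma rsc_answer_uniform: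
  fixes \<iota> :: "'f::{field,finite} \<Rightarrow> 'e::{field,finite}"
  assumes emb: "field_embedding \<iota>" and valid: "valid_query K n Q"
  shows "map_pmf (rsc_answer \<iota> Q \<theta>) (pmf_of_set (message_vectors K)) = pmf_of_set {ys. length ys = n}"
proof (rule map_pmf_of_set_uniform)
  show "finite {ys :: 'e list. length ys = n}"
    using finite_lists_length_eq[of "UNIV :: 'e set" n] by simp
  show "{ys :: 'e list. length ys = n} \<noteq> {}"
    using Ex_list_of_length[of n] by auto
  have len: "length Q = n" and comp: "\<And>k. k < n \<Longrightarrow> valid_component K (Q ! k)" and sep: "separated Q"
    using valid by (auto simp: valid_query_def)
  then show "rsc_answer \<iota> Q \<theta> ` message_vectors K \<subseteq> {ys. length ys = n}"
    by (auto simp: rsc_answer_def)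
  have "\<forall>k. \<exists>v. k < n \<longrightarrow> (\<forall>i. v i = 0 \<longleftrightarrow> i \<notin> set (fst (Q ! k))) \<and>
    (\<forall>x. component_answer \<iota> x (Q ! k) = (\<Sum>i\<in>indices K. \<iota> (v i) * x i))"
    using component_answer_linear[OF emb comp] by blast
  then obtain v where v0: "\<And>k i. k < n \<Longrightarrow> v k i = 0 \<longleftrightarrow> i \<notin> set (fst (Q ! k))"
    and v: "\<And>k x. k < n \<Longrightarrow> component_answer \<iota> x (Q ! k) = (\<Sum>i\<in>indices K. \<iota> (v k i) * x i)"
    by metis
  have "\<forall>k. \<exists>i. k < n \<longrightarrow> i \<in> set (fst (Q ! k)) \<and> (\<forall>k'<n. k' \<noteq> k \<longrightarrow> i \<notin> set (fst (Q ! k')))"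
    using sep len unfolding separated_def by blast
  then obtain p where p: "\<And>k. k < n \<Longrightarrow> p k \<in> set (fst (Q ! k))"
    and p_other: "\<And>k k'. k < n \<Longrightarrow> k' < n \<Longrightarrow> k' \<noteq> k \<Longrightarrow> p k \<notin> set (fst (Q ! k'))"
    by metis
  have p_ind: "p k \<in> indices K" if "k < n" for k
    using p[OF that] comp[OF that] by (auto simp: valid_component_def split_beta)
  fix y y' :: "'e list"
  assume "y \<in> {ys. length ys = n}" "y' \<in> {ys. length ys = n}"
  then have "length y = n" "length y' = n" by auto
  \<comment> \<open>Adding \<open>t k\<close> to the message at the private index \<open>p k\<close>
    moves the answer of component \<open>k\<close> from \<open>y ! k\<close> to
    \<open>y' ! k\<close>.\<close>
  define t where "t k = (y' ! k - y ! k) / \<iota> (v k (p k))" for k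
  \<comment> \<open>Written as a sum over all components, the total shift is defined without first
    proving the private indices distinct.\<close>
  define e where "e i = (\<Sum>k<n. if p k = i then t k else 0)" for i
  \<comment> \<open>The value \<open>undefined\<close> outside the indices keeps \<open>g x\<close>
    extensional, hence a message vector.\<close>
  define g where "g x i = (if i \<in> indices K then x i + e i else undefined)" for x :: "nat \<Rightarrow> 'e" and i
  have e: "(\<Sum>i\<in>indices K. \<iota> (v k i) * e i) = y' ! k - y ! k" if "k < n" for k
  proof -
    have "(\<Sum>i\<in>indices K. \<iota> (v k i) * e i) =
      (\<Sum>i\<in>indices K. \<Sum>k'<n. if p k' = i then \<iota> (v k i) * t k' else 0)"
      unfolding e_def sum_distrib_left by (intro sum.cong refl) simp
    also have "\<dots> = (\<Sum>k'<n. \<Sum>i\<in>indices K. if p k' = i then \<iota> (v k i) * t k' else 0)"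
      by (rule sum.swap)
    also have "\<dots> = (\<Sum>k'<n. \<iota> (v k (p k')) * t k')"
      by (intro sum.cong refl) (simp add: p_ind)
    also have "\<dots> = (\<Sum>k'<n. if k' = k then \<iota> (v k (p k)) * t k else 0)"
    proof (intro sum.cong refl)
      fix k' assume "k' \<in> {..<n}"
      show "\<iota> (v k (p k')) * t k' = (if k' = k then \<iota> (v k (p k)) * t k else 0)"
      proof (cases "k' = k")
        case False
        \<comment> \<open>The index \<open>p k'\<close> is private to component \<open>k'\<close>,
          so its shift is invisible to component \<open>k\<close>.\<close>
        then have "v k (p k') = 0"
          using p_other[of k' k] v0[OF that] \<open>k' \<in> {..<n}\<close> that by simp
        with False show ?thesis
          by (simp add: field_embedding_0[OF emb])
      qed simp
    qed
    also have "\<dots> = y' ! k - y ! k"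
      using that v0[OF that, of "p k"] p[OF that] by (simp add: t_def field_embedding_eq_0_iff[OF emb])
    finally show ?thesis .
  qed
  have "inj_on g (message_vectors K)"
  proof (rule inj_onI)
    fix x x' assume *: "x \<in> message_vectors K" "x' \<in> message_vectors K" "g x = g x'"
    show "x = x'"
    proof
      fix i
      show "x i = x' i"
        using *(1,2) fun_cong[OF *(3), of i]
        by (cases "i \<in> indices K") (auto simp: g_def message_vectors_def PiE_def extensional_def)
    qed
  qed
  moreover have "g x \<in> message_vectors K" for x
    by (auto simp: g_def message_vectors_def)
  moreover have "rsc_answer \<iota> Q \<theta> (g x) = y'" if "rsc_answer \<iota> Q \<theta> x = y" for x
  proof (rule nth_equalityI)
    show "length (rsc_answer \<iota> Q \<theta> (g x)) = length y'"
      by (simp add: rsc_answer_def len \<open>length y' = n\<close>)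
    fix k assume "k < length (rsc_answer \<iota> Q \<theta> (g x))"
    then have "k < n" by (simp add: rsc_answer_def len)
    have "rsc_answer \<iota> Q \<theta> (g x) ! k = (\<Sum>i\<in>indices K. \<iota> (v k i) * (x i + e i))"
      using \<open>k < n\<close> by (simp add: rsc_answer_def len v g_def cong: sum.cong)
    also have "\<dots> = (\<Sum>i\<in>indices K. \<iota> (v k i) * x i) + (y' ! k - y ! k)"
      by (simp add: distrib_left sum.distrib e[OF \<open>k < n\<close>])
    also have "(\<Sum>i\<in>indices K. \<iota> (v k i) * x i) = y ! k"
      using \<open>k < n\<close> unfolding that[symmetric] by (simp add: rsc_answer_def len v)
    finally show "rsc_answer \<iota> Q \<theta> (g x) ! k = y' ! k" by simp
  qed
  ultimately show "\<exists>g. inj_on g (message_vectors K) \<and> (\<forall>x\<in>message_vectors K.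
      g x \<in> message_vectors K \<and> (rsc_answer \<iota> Q \<theta> x = y \<longrightarrow> rsc_answer \<iota> Q \<theta> (g x) = y'))"
    by blast
qed simp_all

lemma finite_valid_queries: "finite {Q :: 'f::{field,finite} component list. valid_query K n Q}"
proof (rule finite_subset)
  let ?A = "{U. set U \<subseteq> indices K \<and> distinct U} \<times> {V :: 'f list. set V \<subseteq> UNIV \<and> length V \<le> K}"
  show "{Q :: 'f component list. valid_query K n Q} \<subseteq> {Q. set Q \<subseteq> ?A \<and> length Q = n}"
  proof clarsimp
    fix Q :: "'f component list" and U V
    assume "valid_query K n Q"
    show "set Q \<subseteq> {U. set U \<subseteq> indices K \<and> distinct U} \<times> {V. length V \<le> K} \<and> length Q = n"
    proof safe
      show "length Q = n" using \<open>valid_query K n Q\<close> by (simp add: valid_query_def)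
      fix U V assume "(U, V) \<in> set Q"
      then have *: "distinct U" "set U \<subseteq> indices K" "length V = length U"
        using \<open>valid_query K n Q\<close> by (auto simp: valid_query_def valid_component_def)
      then show "distinct U" "x \<in> set U \<Longrightarrow> x \<in> indices K" for x by auto
      have "length U \<le> card (indices K)"
        using * by (metis card_mono distinct_card finite_indices)
      then show "length V \<le> K" using * by simp
    qed
  qed
  show "finite {Q. set Q \<subseteq> ?A \<and> length Q = n}"
    by (intro finite_lists_length_eq finite_cartesian_product finite_subset_distinct finite_lists_length_le) simp_all
qed

text \<open>Common reduction for the four cases: what remains specific to a protocol is the shape of
  its queries, a decoding argument and a query law that is the same for all demands. The rate
  depends only on the number \<open>n\<close> of components.\<close>

lemma rsc_protocol_correct:
  fixes \<iota> :: "'f::{field,finite} \<Rightarrow> 'e::{field,finite}"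
  assumes emb: "field_embedding \<iota>" and card: "CARD('e) = q ^ l" "1 \<le> l" "2 \<le> q"
    and M: "1 \<le> M" "M \<le> K" and ans: "answer P = rsc_answer \<iota>"
    and valid: "\<And>W S C Q. W \<in> S \<Longrightarrow> S \<subseteq> indices K \<Longrightarrow> card S = M \<Longrightarrow> C \<in> coeff_seqs M \<Longrightarrow>
      Q \<in> set_pmf (query P W S C) \<Longrightarrow> valid_query K n Q"
    and decode: "\<And>W S C Q x x'. W \<in> S \<Longrightarrow> S \<subseteq> indices K \<Longrightarrow> card S = M \<Longrightarrow> C \<in> coeff_seqs M \<Longrightarrow>
      Q \<in> set_pmf (query P W S C) \<Longrightarrow>
      (\<And>c. c \<in> set Q \<Longrightarrow> component_answer \<iota> x c = component_answer \<iota> x' c) \<Longrightarrow>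
      side_info \<iota> S C x = side_info \<iota> S C x' \<Longrightarrow> x W = x' W"
    and priv: "\<And>W. W \<in> indices K \<Longrightarrow> query_law K M P W = D"
  shows "scalar_linear \<iota> K M P \<and> pir_csi_II \<iota> K M P \<and> rate q l K M P = 1 / real n"
proof -
  have fin: "finite (set_pmf (model_II K M P))"
    by (rule finite_set_model_II[OF M finite_valid_queries[of K n]]) (use valid in blast)
  have "scalar_linear \<iota> K M P"
    unfolding scalar_linear_def
  proof clarify
    fix \<omega> assume "\<omega> \<in> set_pmf (model_II K M P)"
    note * = set_model_II[OF M this]
    have "\<forall>c\<in>set (rQ \<omega>). \<exists>v. \<forall>x. component_answer \<iota> x c = (\<Sum>i\<in>indices K. \<iota> (v i) * x i)"
      using valid[OF *(3,1,2,4,6)] component_answer_linear[OF emb] unfolding valid_query_def by metis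
    then obtain v where "\<And>c x. c \<in> set (rQ \<omega>) \<Longrightarrow>
        component_answer \<iota> x c = (\<Sum>i\<in>indices K. \<iota> (v c i) * x i)"
      by metis
    then show "\<exists>vs. \<forall>x\<in>message_vectors K.
        answer P (rQ \<omega>) (rInd \<omega>) x = map (\<lambda>v. \<Sum>i\<in>indices K. \<iota> (v i) * x i) vs"
      by (intro exI[of _ "map v (rQ \<omega>)"]) (simp add: ans rsc_answer_def)
  qed
  moreover have "recoverability \<iota> K M P"
  proof (rule recoverability_if_decodable[OF M fin])
    fix W S C Q x x'
    assume *: "W \<in> S" "S \<subseteq> indices K" "card S = M" "C \<in> coeff_seqs M" "Q \<in> set_pmf (query P W S C)"
      "answer P Q 1 x = answer P Q 1 x'" "side_info \<iota> S C x = side_info \<iota> S C x'"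
    show "x W = x' W"
      by (rule decode[OF *(1-5) _ *(7)]) (use *(6) in \<open>simp add: ans rsc_answer_def\<close>)
  qed
  moreover have "W_privacy K M P"
    using M fin priv by (rule W_privacy_if_query_law_constant)
  moreover have "rate q l K M P = 1 / real n"
  proof (rule rate_uniform_answer[OF M fin])
    show "map_pmf (rA P) (model_II K M P) = pmf_of_set {ys. length ys = n}"
      unfolding ans by (rule answer_law[OF M]) (simp add: ans rsc_answer_uniform[OF emb valid])
    show "card {ys :: 'e list. length ys = n} = (q ^ l) ^ n"
      using card_lists_length_eq[of "UNIV :: 'e set" n] card by simp
  qed (use card in auto)
  ultimately show ?thesis
    by (simp add: pir_csi_II_def)
qed

text \<open>This fits the component from which the user decodes, where indices and coefficients are
  listed along the same set. In the decoy component of Cases 2 and 3 the coefficients come from a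
  different set.\<close>

lemma component_answer_map:
  "finite A \<Longrightarrow> component_answer \<iota> x (sorted_list_of_set A, map c (sorted_list_of_set A)) =
    (\<Sum>i\<in>A. \<iota> (c i) * x i)"
  by (simp add: component_answer_def zip_map2 zip_same_conv_map o_def sum_list_distinct_conv_sum_set split_beta)

section \<open>Laws of the coefficients\<close>

lemma pair_pmf_of_set:
  assumes "finite A" "A \<noteq> {}" "finite B" "B \<noteq> {}"
  shows "pair_pmf (pmf_of_set A) (pmf_of_set B) = pmf_of_set (A \<times> B)"
proof (rule pmf_eqI, clarify)
  fix a b
  show "pmf (pair_pmf (pmf_of_set A) (pmf_of_set B)) (a, b) = pmf (pmf_of_set (A \<times> B)) (a, b)"
    using assms by (simp add: pmf_pair indicator_def card_cartesian_product)
qed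

text \<open>Each \<open>x\<close> is reached from the \<open>card A - 1\<close> other points, with
  probability \<open>1 / (card A - 1)\<close> from each: the uniform law is stationary under a
  uniform move to a different point.\<close>

lemma pmf_of_set_bind_remove:
  assumes "finite A" "2 \<le> card A"
  shows "pmf_of_set A \<bind> (\<lambda>a. pmf_of_set (A - {a})) = pmf_of_set A"
proof (rule pmf_eqI)
  fix x
  have ne: "A \<noteq> {}" using assms by auto
  have ne': "A - {a} \<noteq> {}" if "a \<in> A" for a
  proof -
    have "card (A - {a}) > 0" using assms that by simp
    then show ?thesis by (metis card.empty less_irrefl)
  qed
  have "pmf (pmf_of_set A \<bind> (\<lambda>a. pmf_of_set (A - {a}))) x =
      (\<Sum>a\<in>A. pmf (pmf_of_set (A - {a})) x) / card A"
    using assms ne by (subst pmf_bind_pmf_of_set) auto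
  also have "(\<Sum>a\<in>A. pmf (pmf_of_set (A - {a})) x) = (\<Sum>a\<in>A. indicator (A - {a}) x / (card A - 1))"
    using assms ne' by (intro sum.cong refl) simp
  also have "\<dots> = indicator A x"
  proof (cases "x \<in> A")
    case True
    then have "(\<Sum>a\<in>A. indicator (A - {a}) x / (card A - 1)) =
        (\<Sum>a\<in>A - {x}. indicator (A - {a}) x / real (card A - 1))"
      using assms by (subst sum.remove[of A x]) auto
    also have "\<dots> = (\<Sum>a\<in>A - {x}. 1 / real (card A - 1))"
      using True by (intro sum.cong refl) auto
    also have "\<dots> = 1"
      using True assms by simp
    finally show ?thesis using True by simp
  qed (simp add: indicator_def)
  also have "indicator A x / card A = pmf (pmf_of_set A) x"
    using assms ne by simp
  finally show "pmf (pmf_of_set A \<bind> (\<lambda>a. pmf_of_set (A - {a}))) x = pmf (pmf_of_set A) x" .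
qed

text \<open>The function \<open>coef\<close> looks an index up by its rank in \<open>S\<close>, and
  the entry at position \<open>i\<close> of the increasing enumeration has exactly \<open>i\<close>
  smaller elements in \<open>S\<close>.\<close>

lemma map_coef_sorted_list_of_set:
  assumes "finite S" "length C = card S"
  shows "map (coef S C) (sorted_list_of_set S) = C"
proof (rule nth_equalityI)
  let ?xs = "sorted_list_of_set S"
  show "length (map (coef S C) ?xs) = length C" using assms by simp
  fix i assume "i < length (map (coef S C) ?xs)"
  then have i: "i < length ?xs" by simp
  have "{j \<in> S. j < ?xs ! i} = (!) ?xs ` {..<i}"
  proof (intro equalityI subsetI)
    fix j assume "j \<in> {j \<in> S. j < ?xs ! i}"
    then obtain m where m: "m < length ?xs" "j = ?xs ! m" "?xs ! m < ?xs ! i"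
      using assms by (metis (no_types, lifting) in_set_conv_nth mem_Collect_eq set_sorted_list_of_set)
    then have "m < i"
      by (metis i sorted_nth_mono sorted_sorted_list_of_set linorder_not_le)
    with m show "j \<in> (!) ?xs ` {..<i}" by blast
  next
    fix j assume "j \<in> (!) ?xs ` {..<i}"
    then obtain m where m: "m < i" "j = ?xs ! m" by auto
    then have "j < ?xs ! i"
      using i sorted_wrt_nth_less[OF strict_sorted_list_of_set] by blast
    moreover have "j \<in> S"
      using m i assms by (metis nth_mem order.strict_trans set_sorted_list_of_set)
    ultimately show "j \<in> {j \<in> S. j < ?xs ! i}" by simp
  qed
  moreover have "inj_on ((!) ?xs) {..<i}"
    using i by (intro inj_on_nth) auto
  ultimately have "card {j \<in> S. j < ?xs ! i} = i"
    by (simp add: card_image)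
  then show "map (coef S C) ?xs ! i = C ! i"
    using i by (simp add: coef_def)
qed

lemma length_uniform_coeff_seqs:
  assumes "V \<in> set_pmf (pmf_of_set (coeff_seqs n :: 'f::{field,finite} list set))"
  shows "length V = n"
proof -
  have "V \<in> coeff_seqs n" using assms by simp
  then show ?thesis by (simp add: coeff_seqs_def)
qed

definition insert_at :: "nat \<Rightarrow> 'a \<Rightarrow> 'a list \<Rightarrow> 'a list" where
  "insert_at k c V = take k V @ c # drop k V"

text \<open>Inserting at position \<open>k\<close> is a bijection, inverted by reading off and
  deleting that entry. Hence the entry at \<open>k\<close> is uniform on the nonzero scalars and
  independent of the remaining sequence.\<close>

lemma uniform_coeff_seqs_insert_at:
  assumes "k < M"
  shows "pmf_of_set (coeff_seqs M :: 'f::{field,finite} list set) =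
    map_pmf (\<lambda>(c, V). insert_at k c V) (pair_pmf (pmf_of_set (UNIV - {0})) (pmf_of_set (coeff_seqs (M - 1))))"
proof -
  let ?A = "(UNIV - {0 :: 'f}) \<times> (coeff_seqs (M - 1) :: 'f list set)"
  have ne: "UNIV - {0 :: 'f} \<noteq> {}"
    using one_neq_zero by blast
  have "bij_betw (\<lambda>(c, V). insert_at k c V) ?A (coeff_seqs M)"
  proof (rule bij_betw_byWitness[where f' = "\<lambda>C. (C ! k, take k C @ drop (Suc k) C)"])
    show "\<forall>a\<in>?A. ((case a of (c, V) \<Rightarrow> insert_at k c V) ! k,
        take k (case a of (c, V) \<Rightarrow> insert_at k c V) @ drop (Suc k) (case a of (c, V) \<Rightarrow> insert_at k c V)) = a"
      using assms by (auto simp: coeff_seqs_def insert_at_def nth_append)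
    show "\<forall>C\<in>coeff_seqs M. (case (C ! k, take k C @ drop (Suc k) C) of (c, V) \<Rightarrow> insert_at k c V) = C"
      using assms by (auto simp: coeff_seqs_def insert_at_def id_take_nth_drop[symmetric])
    show "(\<lambda>(c, V). insert_at k c V) ` ?A \<subseteq> coeff_seqs M"
      using assms by (auto simp: coeff_seqs_def insert_at_def dest: in_set_takeD in_set_dropD)
    show "(\<lambda>C. (C ! k, take k C @ drop (Suc k) C)) ` coeff_seqs M \<subseteq> ?A"
      using assms by (auto simp: coeff_seqs_def dest: in_set_takeD in_set_dropD) (metis nth_mem)
  qed
  moreover have "pair_pmf (pmf_of_set (UNIV - {0})) (pmf_of_set (coeff_seqs (M - 1))) = pmf_of_set ?A"
    by (rule pair_pmf_of_set[OF _ ne _ coeff_seqs_nonempty]) simp_all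
  moreover have "?A \<noteq> {}" "finite ?A"
    using ne coeff_seqs_nonempty by blast simp
  ultimately show ?thesis
    by (simp only:) (rule map_pmf_of_set_bij_betw[symmetric])
qed

text \<open>The position \<open>k\<close> is the rank of \<open>W\<close> in \<open>S\<close>. It
  must be chosen before \<open>c\<close> and \<open>V\<close>, so that one decomposition of the
  random sequence serves for all its values.\<close>

lemma map_coef_insert_at:
  fixes S :: "nat set"
  assumes "finite S" "W \<in> S"
  shows "\<exists>k<card S. \<forall>(c::'f) V. length V = card S - 1 \<longrightarrow>
    coef S (insert_at k c V) W = c \<and>
    map (coef S (insert_at k c V)) (sorted_list_of_set (S - {W})) = V \<and>
    (\<forall>c'. map ((coef S (insert_at k c V))(W := c')) (sorted_list_of_set S) = insert_at k c' V)"
proof -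
  have "W \<in> set (sorted_list_of_set S)" using assms by simp
  \<comment> \<open>The length of \<open>ls\<close> is the rank of \<open>W\<close>; removing
    \<open>W\<close> from the enumeration leaves \<open>ls @ rs\<close>.\<close>
  then obtain ls rs where xs: "sorted_list_of_set S = ls @ W # rs" "W \<notin> set ls"
    using split_list_first by metis
  have "distinct (ls @ W # rs)"
    using distinct_sorted_list_of_set[of S] unfolding xs(1) .
  then have W: "W \<notin> set rs" by simp
  have len: "length ls + length rs = card S - 1" "length ls < card S"
    using length_sorted_list_of_set[of S] unfolding xs(1) by simp_all
  have rm: "sorted_list_of_set (S - {W}) = ls @ rs"
    using assms xs by (simp add: sorted_list_of_set_remove remove1_append)
  have "coef S (insert_at (length ls) c V) W = c \<and>
    map (coef S (insert_at (length ls) c V)) (sorted_list_of_set (S - {W})) = V \<and>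
    (\<forall>c'. map ((coef S (insert_at (length ls) c V))(W := c')) (sorted_list_of_set S) = insert_at (length ls) c' V)"
    if V: "length V = card S - 1" for c :: 'f and V
  proof -
    let ?f = "coef S (insert_at (length ls) c V)"
    have "map ?f (sorted_list_of_set S) = insert_at (length ls) c V"
      using assms len V by (intro map_coef_sorted_list_of_set) (auto simp: insert_at_def)
    then have "map ?f ls @ ?f W # map ?f rs = take (length ls) V @ c # drop (length ls) V"
      unfolding xs(1) by (simp add: insert_at_def)
    then have *: "map ?f ls = take (length ls) V" "?f W = c" "map ?f rs = drop (length ls) V"
      using len V by (auto simp: append_eq_append_conv)
    moreover have "map (?f(W := c')) ls = map ?f ls" "map (?f(W := c')) rs = map ?f rs" for c'
      using xs(2) W by auto
    ultimately show ?thesis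
      unfolding rm xs(1) by (simp add: insert_at_def)
  qed
  with len(2) show ?thesis by blast
qed

text \<open>Dropping the coefficient of the demand is the projection to the second factor of the
  decomposition by \<open>insert_at\<close>.\<close>

lemma uniform_coeffs_removed:
  assumes "finite S" "W \<in> S"
  shows "map_pmf (\<lambda>C. map (coef S C) (sorted_list_of_set (S - {W})))
    (pmf_of_set (coeff_seqs (card S) :: 'f::{field,finite} list set)) = pmf_of_set (coeff_seqs (card S - 1))"
proof -
  obtain k where k: "k < card S" "\<And>(c::'f) V. length V = card S - 1 \<Longrightarrow>
      map (coef S (insert_at k c V)) (sorted_list_of_set (S - {W})) = V"
    using map_coef_insert_at[OF assms] by metis
  have "map_pmf (\<lambda>C. map (coef S C) (sorted_list_of_set (S - {W}))) (pmf_of_set (coeff_seqs (card S) :: 'f list set)) =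
    map_pmf snd (pair_pmf (pmf_of_set (UNIV - {0 :: 'f})) (pmf_of_set (coeff_seqs (card S - 1))))"
    unfolding uniform_coeff_seqs_insert_at[OF k(1)] pmf.map_comp
    by (rule map_pmf_cong[OF refl]) (auto simp: k(2) length_uniform_coeff_seqs)
  then show ?thesis by (simp add: map_snd_pair_pmf)
qed

text \<open>The coefficient of the demand is independent of the remaining sequence, so the latter
  can be drawn first. The redrawn coefficient is then again uniform, and reinserting it rebuilds a
  uniform sequence.\<close>

lemma uniform_coeffs_replaced:
  assumes "finite S" "W \<in> S" "3 \<le> CARD('f::{field,finite})"
  shows "do {
      C \<leftarrow> pmf_of_set (coeff_seqs (card S));
      c \<leftarrow> pmf_of_set (UNIV - {0, coef S C W});
      return_pmf (map ((coef S C)(W := c)) (sorted_list_of_set S))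
    } = pmf_of_set (coeff_seqs (card S) :: 'f list set)"
    (is "?L = _")
proof -
  obtain k where k: "k < card S" "\<And>(c::'f) V. length V = card S - 1 \<Longrightarrow> coef S (insert_at k c V) W = c"
      "\<And>(c::'f) V c'. length V = card S - 1 \<Longrightarrow>
        map ((coef S (insert_at k c V))(W := c')) (sorted_list_of_set S) = insert_at k c' V"
    using map_coef_insert_at[OF assms(1,2)] by metis
  let ?V = "pmf_of_set (coeff_seqs (card S - 1) :: 'f list set)" and ?u = "pmf_of_set (UNIV - {0 :: 'f})"
  have len: "length V = card S - 1" if "V \<in> set_pmf ?V" for V
    using that by (rule length_uniform_coeff_seqs)
  have "?L = ?u \<bind> (\<lambda>c0. ?V \<bind> (\<lambda>V. pmf_of_set (UNIV - {0, c0}) \<bind> (\<lambda>c. return_pmf (insert_at k c V))))"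
    unfolding uniform_coeff_seqs_insert_at[OF k(1)] pair_pmf_def map_bind_pmf bind_assoc_pmf map_return_pmf
      bind_return_pmf bind_map_pmf prod.case
    by (intro bind_pmf_cong[OF refl]) (simp add: k len)
  also have "\<dots> = ?V \<bind> (\<lambda>V. ?u \<bind> (\<lambda>c0. pmf_of_set (UNIV - {0, c0}) \<bind> (\<lambda>c. return_pmf (insert_at k c V))))"
    by (rule bind_commute_pmf)
  also have "\<dots> = ?V \<bind> (\<lambda>V. (?u \<bind> (\<lambda>c0. pmf_of_set (UNIV - {0} - {c0}))) \<bind> (\<lambda>c. return_pmf (insert_at k c V)))"
    unfolding bind_assoc_pmf by (simp add: Diff_insert[symmetric] insert_commute)
  \<comment> \<open>Since \<open>q >= 3\<close>, there are at least two nonzero scalars, so the move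
    away from \<open>c0\<close> is possible and preserves uniformity.\<close>
  also have "?u \<bind> (\<lambda>c0. pmf_of_set (UNIV - {0} - {c0})) = ?u"
    using assms(3) by (intro pmf_of_set_bind_remove) (auto simp: card_Diff_singleton)
  also have "?V \<bind> (\<lambda>V. ?u \<bind> (\<lambda>c. return_pmf (insert_at k c V))) =
      ?u \<bind> (\<lambda>c. ?V \<bind> (\<lambda>V. return_pmf (insert_at k c V)))"
    by (rule bind_commute_pmf)
  also have "\<dots> = pmf_of_set (coeff_seqs (card S))"
    unfolding uniform_coeff_seqs_insert_at[OF k(1)] pair_pmf_def map_bind_pmf map_return_pmf prod.case
    by simp
  finally show ?thesis .
qed

section \<open>Random order of two components, well-formed queries and decoding\<close>

lemma pmf_bernoulli_bind:
  assumes "0 \<le> p" "p \<le> 1"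
  shows "pmf (bernoulli_pmf p \<bind> f) x = p * pmf (f True) x + (1 - p) * pmf (f False) x"
  using assms by (simp add: pmf_bind mult.commute)

text \<open>Symmetrisation over the order of the pair: all that a shuffled query can reveal about
  the law of the index sets.\<close>

definition coin_swap :: "('a \<times> 'a) pmf \<Rightarrow> ('a \<times> 'a) pmf" where
  "coin_swap E = bernoulli_pmf (1 / 2) \<bind> (\<lambda>swap. if swap then map_pmf prod.swap E else E)"

lemma pmf_coin_swap: "pmf (coin_swap E) (a, b) = (pmf E (a, b) + pmf E (b, a)) / 2"
proof -
  have "pmf (map_pmf prod.swap E) (a, b) = pmf E (b, a)"
    by (rule pmf_map_eq) auto
  then show ?thesis
    by (simp add: coin_swap_def pmf_bernoulli_bind)
qed

definition pair_query_law :: "nat \<Rightarrow> (nat set \<times> nat set) pmf \<Rightarrow> 'f::{field,finite} component list pmf" where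
  "pair_query_law m E = do {
     (A, B) \<leftarrow> E;
     V \<leftarrow> pmf_of_set (coeff_seqs m);
     random_order (sorted_list_of_set A, V) (sorted_list_of_set B, V)
   }"

text \<open>Both components carry the same \<open>V\<close>, so shuffling them amounts to exchanging
  \<open>A\<close> and \<open>B\<close> before \<open>V\<close> is attached. Privacy thereby reduces
  to equality of symmetrised index laws.\<close>

lemma pair_query_law_coin_swap:
  "pair_query_law m E = do {
     (A, B) \<leftarrow> coin_swap E;
     V \<leftarrow> pmf_of_set (coeff_seqs m);
     return_pmf [(sorted_list_of_set A, V), (sorted_list_of_set B, V)]
   }"
proof -
  let ?r = "\<lambda>(A, B) V s. return_pmf (if s then [(sorted_list_of_set B, V), (sorted_list_of_set A, V)]
    else [(sorted_list_of_set A, V), (sorted_list_of_set B, V)])"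
  let ?b = "bernoulli_pmf (1 / 2)" and ?V = "pmf_of_set (coeff_seqs m)"
  have "pair_query_law m E = E \<bind> (\<lambda>AB. ?V \<bind> (\<lambda>V. ?b \<bind> (\<lambda>s. ?r AB V s)))"
    by (simp add: pair_query_law_def random_order_def map_pmf_def case_prod_unfold)
  also have "\<dots> = E \<bind> (\<lambda>AB. ?b \<bind> (\<lambda>s. ?V \<bind> (\<lambda>V. ?r AB V s)))"
    by (subst bind_commute_pmf) (rule refl)
  also have "\<dots> = ?b \<bind> (\<lambda>s. E \<bind> (\<lambda>AB. ?V \<bind> (\<lambda>V. ?r AB V s)))"
    by (rule bind_commute_pmf)
  also have "\<dots> = ?b \<bind> (\<lambda>s. (if s then map_pmf prod.swap E else E) \<bind> (\<lambda>AB. ?V \<bind> (\<lambda>V. ?r AB V False)))"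
    by (intro bind_pmf_cong[OF refl]) (simp add: bind_map_pmf case_prod_unfold)
  also have "\<dots> = coin_swap E \<bind> (\<lambda>AB. ?V \<bind> (\<lambda>V. ?r AB V False))"
    by (simp add: coin_swap_def bind_assoc_pmf)
  finally show ?thesis
    by (simp add: case_prod_unfold)
qed

lemma set_random_order: "set_pmf (random_order Q1 Q2) = {[Q1, Q2], [Q2, Q1]}"
  by (auto simp: random_order_def)

text \<open>Two different finite sets of equal size do not contain one another, so each has an
  element missing from the other; these are the private indices.\<close>

lemma valid_query_pair:
  assumes "A \<subseteq> indices K" "B \<subseteq> indices K" "card A = m" "card B = m" "A \<noteq> B" "V \<in> coeff_seqs m"
    and Q: "Q \<in> {[(sorted_list_of_set A, V), (sorted_list_of_set B, V)],
      [(sorted_list_of_set B, V), (sorted_list_of_set A, V)]}"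
  shows "valid_query K 2 Q"
proof -
  have fin: "finite A" "finite B" using assms(1,2) by (auto intro: finite_subset[OF _ finite_indices])
  have "\<not> A \<subseteq> B" "\<not> B \<subseteq> A"
    using assms fin card_subset_eq by metis+
  then have ex: "\<exists>a\<in>A. a \<notin> B" "\<exists>b\<in>B. b \<notin> A" by blast+
  have "separated Q"
    using Q fin unfolding separated_def
    by (auto simp: less_Suc_eq numeral_2_eq_2) (use ex in blast)+
  then show ?thesis
    using Q fin assms(3,4,6) unfolding valid_query_def valid_component_def
    by (auto simp: coeff_seqs_def) (use assms(1,2) in blast)+
qed

lemma valid_query_single:
  assumes "A \<subseteq> indices K" "A \<noteq> {}" "V \<in> coeff_seqs (card A)"
  shows "valid_query K 1 [(sorted_list_of_set A, V)]"
proof -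
  have "finite A" using assms(1) by (rule finite_subset) simp
  then show ?thesis
    using assms unfolding valid_query_def valid_component_def separated_def coeff_seqs_def by auto
qed

text \<open>The difference of the two combinations is \<open>x W\<close> times the image of
  \<open>f W - g W\<close>, which is nonzero because the embedding is injective. The function
  \<open>g\<close> describes the decoding component, with coefficient 0 at \<open>W\<close> in Case
  2 and the replaced one in Cases 3 and 4.\<close>

lemma decode_message:
  fixes \<iota> :: "'f::field \<Rightarrow> 'e::field"
  assumes emb: "field_embedding \<iota>" and "finite S" "W \<in> S"
    and eq: "\<And>i. i \<in> S - {W} \<Longrightarrow> f i = g i" and ne: "f W \<noteq> g W"
    and f: "(\<Sum>i\<in>S. \<iota> (f i) * x i) = (\<Sum>i\<in>S. \<iota> (f i) * x' i)"
    and g: "(\<Sum>i\<in>S. \<iota> (g i) * x i) = (\<Sum>i\<in>S. \<iota> (g i) * x' i)"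
  shows "x W = x' W"
proof -
  have split: "(\<Sum>i\<in>S. \<iota> (f i) * z i) = \<iota> (f W) * z W + (\<Sum>i\<in>S - {W}. \<iota> (g i) * z i)"
    "(\<Sum>i\<in>S. \<iota> (g i) * z i) = \<iota> (g W) * z W + (\<Sum>i\<in>S - {W}. \<iota> (g i) * z i)" for z
    using assms(2,3) eq by (simp_all add: sum.remove[of S W])
  have "\<iota> (f W) = \<iota> (f W - g W) + \<iota> (g W)"
    using emb unfolding field_embedding_def by (metis diff_add_cancel)
  then have "\<iota> (f W - g W) * z W = (\<Sum>i\<in>S. \<iota> (f i) * z i) - (\<Sum>i\<in>S. \<iota> (g i) * z i)" for z
    unfolding split by (simp add: distrib_right)
  from this[of x] this[of x'] have "\<iota> (f W - g W) * x W = \<iota> (f W - g W) * x' W"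
    using f g by simp
  then show ?thesis
    using field_embedding_eq_0_iff[OF emb, of "f W - g W"] ne by simp
qed

lemma coef_nonzero:
  assumes "finite S" "W \<in> S" "C \<in> coeff_seqs (card S)"
  shows "coef S C W \<noteq> 0"
proof -
  have "coef S C W \<in> set (map (coef S C) (sorted_list_of_set S))"
    using assms by simp
  also have "map (coef S C) (sorted_list_of_set S) = C"
    using assms by (intro map_coef_sorted_list_of_set) (auto simp: coeff_seqs_def)
  finally show ?thesis
    using assms(3) by (auto simp: coeff_seqs_def)
qed

lemma map_nonzero_in_coeff_seqs:
  assumes "finite A" "\<And>i. i \<in> A \<Longrightarrow> f i \<noteq> 0"
  shows "map f (sorted_list_of_set A) \<in> coeff_seqs (card A)"
  using assms by (auto simp: coeff_seqs_def)

text \<open>Here \<open>h\<close> is the rest of the protocol, which sees the coefficients only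
  after the replacement.\<close>

lemma uniform_coeffs_replaced_bind:
  fixes h :: "'f::{field,finite} list \<Rightarrow> 'b pmf"
  assumes "finite S" "W \<in> S" "3 \<le> CARD('f)"
  shows "pmf_of_set (coeff_seqs (card S)) \<bind> (\<lambda>C. pmf_of_set (UNIV - {0, coef S C W}) \<bind>
      (\<lambda>c. h (map ((coef S C)(W := c)) (sorted_list_of_set S)))) = pmf_of_set (coeff_seqs (card S)) \<bind> h"
  using arg_cong[OF uniform_coeffs_replaced[OF assms], of "\<lambda>p. p \<bind> h"]
  by (simp only: bind_assoc_pmf bind_return_pmf)

text \<open>With \<open>q >= 3\<close> the set of admissible scalars is nonempty; over an empty set
  \<open>pmf_of_set\<close> would carry no information.\<close>

lemma set_pmf_of_nonzero_other:
  fixes a :: "'f::{field,finite}"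
  assumes "3 \<le> CARD('f)" "c \<in> set_pmf (pmf_of_set (UNIV - {0, a}))"
  shows "c \<noteq> 0" "c \<noteq> a"
proof -
  have "card {0, a} < CARD('f)"
    using assms(1) card_insert_le_m1[of 2 "{a}" 0] by (simp add: card_insert_if split: if_splits)
  then have "UNIV - {0, a} \<noteq> {}"
    by (metis Diff_eq_empty_iff UNIV_I card_mono finite linorder_not_le)
  then have "c \<in> UNIV - {0, a}"
    using assms(2) by (metis finite set_pmf_of_set)
  then show "c \<noteq> 0" "c \<noteq> a" by auto
qed

text \<open>Quotient of adjacent binomial coefficients. It compares the weight of a single decoy set
  containing the demand with that of one avoiding it.\<close>

lemma binomial_ratio:
  assumes "Suc j \<le> n"
  shows "(real n - real j) / real (n choose Suc j) = real (Suc j) / real (n choose j)"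
proof -
  have "(n - j) * (n choose j) = Suc j * (n choose Suc j)"
    using binomial_absorb_comp[of n j] binomial_absorption[of j n] by simp
  then have "real (n - j) * real (n choose j) = real (Suc j) * real (n choose Suc j)"
    by (metis of_nat_mult)
  moreover have "real (n - j) = real n - real j" using assms by simp
  moreover have "(n choose j) > 0" "(n choose Suc j) > 0" using assms by simp_all
  ultimately show ?thesis
    by (simp add: frac_eq_eq)
qed

section \<open>One query component\<close>

text \<open>The demand is sent with probability \<open>1/K\<close>, and any other index with
  probability \<open>(K-1)/K * 1/(K-1) = 1/K\<close>, since the other element of \<open>S\<close> is
  uniform among the remaining indices.\<close>

lemma decoy_index_uniform:
  assumes "W \<in> indices K" "2 \<le> K"
  shows "bernoulli_pmf (1 / real K) \<bind> (\<lambda>own. if own then return_pmf W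
      else map_pmf (\<lambda>A. the_elem (insert W A - {W})) (random_subset 1 (indices K - {W}))) = pmf_of_set (indices K)"
proof (rule pmf_eqI)
  fix i
  let ?r = "map_pmf (\<lambda>A. the_elem (insert W A - {W})) (random_subset 1 (indices K - {W}))"
  have card: "card (indices K - {W}) = K - 1" using assms by simp
  have elem: "\<exists>a. A = {a} \<and> a \<in> indices K \<and> a \<noteq> W \<and> the_elem (insert W A - {W}) = a"
    if "A \<in> set_pmf (random_subset 1 (indices K - {W}))" for A
  proof -
    have "A \<subseteq> indices K - {W}" "card A = 1"
      using that assms card by (simp_all add: subsets_of_size_def)
    then obtain a where "A = {a}" "a \<in> indices K" "a \<noteq> W"
      by (metis card_1_singletonE insert_subset Diff_iff singletonI)
    moreover from this have "insert W A - {W} = {a}" by auto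
    ultimately show ?thesis by simp
  qed
  have r: "pmf ?r i = (if i \<in> indices K \<and> i \<noteq> W then 1 / (K - 1) else 0)"
  proof (cases "i \<in> indices K \<and> i \<noteq> W")
    case True
    have "pmf ?r i = pmf (random_subset 1 (indices K - {W})) {i}"
      by (rule pmf_map_eq) (use elem in fastforce)
    then show ?thesis using True assms card by (simp add: pmf_random_subset)
  next
    case False
    have "pmf ?r i = 0"
      by (rule pmf_map_eq_0) (use elem False in fastforce)
    then show ?thesis by (simp only: if_not_P[OF False])
  qed
  have ne: "indices K \<noteq> {}" using assms by auto
  have p: "0 \<le> 1 / real K" "1 / real K \<le> 1" using assms by simp_all
  show "pmf (bernoulli_pmf (1 / real K) \<bind> (\<lambda>own. if own then return_pmf W else ?r)) i = pmf (pmf_of_set (indices K)) i"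
    unfolding pmf_bernoulli_bind[OF p] if_True if_False r
    using assms ne by (auto simp: indicator_def divide_simps of_nat_diff)
qed

lemma rsc_1_correct:
  fixes \<iota> :: "'f::{field,finite} \<Rightarrow> 'e::{field,finite}"
  assumes emb: "field_embedding \<iota>" and "CARD('e) = q ^ l" "1 \<le> l" "2 \<le> q" and K: "2 \<le> K"
  shows "scalar_linear \<iota> K 2 (rsc_1 \<iota> K) \<and> pir_csi_II \<iota> K 2 (rsc_1 \<iota> K) \<and> rate q l K 2 (rsc_1 \<iota> K) = 1 / real 1"
proof (rule rsc_protocol_correct[OF assms(1-4)])
  show "1 \<le> (2::nat)" "2 \<le> K" "answer (rsc_1 \<iota> K) = rsc_answer \<iota>"
    using K by (simp_all add: rsc_1_def)
next
  fix W S C Q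
  assume S: "W \<in> S" "S \<subseteq> indices K" "card S = 2" and C: "C \<in> coeff_seqs 2"
    and Q: "Q \<in> set_pmf (query (rsc_1 \<iota> K) W S C)"
  have "finite S" using S by (auto intro: card_ge_0_finite)
  then have "card (S - {W}) = 1" using S by simp
  then obtain j where j: "S - {W} = {j}" by (rule card_1_singletonE)
  then have SWj: "S = {W, j}" "W \<noteq> j" using S by auto
  obtain i where i: "i \<in> S" "Q = [([i], [1])]"
    using Q S(1) by (auto simp: rsc_1_def rsc_query_1_def Let_def j SWj split: if_splits)
  show "valid_query K 1 Q"
    using i S by (auto simp: valid_query_def valid_component_def separated_def)
  fix x x' :: "nat \<Rightarrow> 'e"
  assume ans: "\<And>c. c \<in> set Q \<Longrightarrow> component_answer \<iota> x c = component_answer \<iota> x' c"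
    and side: "side_info \<iota> S C x = side_info \<iota> S C x'"
  have "x i = x' i"
    using ans[of "([i], [1])"] i emb by (simp add: component_answer_def field_embedding_def)
  show "x W = x' W"
  proof (cases "i = W")
    case False
    then have "i = j" using i SWj by simp
    \<comment> \<open>The decoy \<open>j\<close> was sent: its term cancels from the side
      information, leaving \<open>x W\<close> times a nonzero coefficient.\<close>
    have "coef S C W \<noteq> 0" using \<open>finite S\<close> S C by (intro coef_nonzero) simp_all
    with \<open>x i = x' i\<close> \<open>i = j\<close> show ?thesis
      using side SWj field_embedding_eq_0_iff[OF emb] by (simp add: side_info_def)
  qed (use \<open>x i = x' i\<close> in simp)
next
  fix W assume W: "W \<in> indices K"
  let ?R = "random_subset 1 (indices K - {W})"
  have "query_law K 2 (rsc_1 \<iota> K) W = ?R \<bind> (\<lambda>A. bernoulli_pmf (1 / real K) \<bind> (\<lambda>own.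
      return_pmf [([if own then W else the_elem (insert W A - {W})], [1])]))"
    by (simp add: query_law_def rsc_1_def rsc_query_1_def Let_def)
  also have "\<dots> = bernoulli_pmf (1 / real K) \<bind> (\<lambda>own. ?R \<bind> (\<lambda>A.
      return_pmf [([if own then W else the_elem (insert W A - {W})], [1])]))"
    by (rule bind_commute_pmf)
  also have "\<dots> = map_pmf (\<lambda>i. [([i], [1])]) (bernoulli_pmf (1 / real K) \<bind> (\<lambda>own. if own then return_pmf W
      else map_pmf (\<lambda>A. the_elem (insert W A - {W})) ?R))"
    unfolding map_bind_pmf
    by (intro bind_pmf_cong[OF refl]) (simp add: pmf.map_comp o_def map_pmf_def bind_assoc_pmf bind_return_pmf)
  finally show "query_law K 2 (rsc_1 \<iota> K) W = map_pmf (\<lambda>i. [([i], [1])]) (pmf_of_set (indices K))"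
    unfolding decoy_index_uniform[OF W K] .
qed

lemma rsc_4_correct:
  fixes \<iota> :: "'f::{field,finite} \<Rightarrow> 'e::{field,finite}"
  assumes emb: "field_embedding \<iota>" and "CARD('e) = q ^ l" "1 \<le> l" "2 \<le> q" and F: "3 \<le> CARD('f)" and K: "1 \<le> K"
  shows "scalar_linear \<iota> K K (rsc_4 \<iota> K) \<and> pir_csi_II \<iota> K K (rsc_4 \<iota> K) \<and> rate q l K K (rsc_4 \<iota> K) = 1 / real 1"
proof (rule rsc_protocol_correct[OF assms(1-4)])
  show "1 \<le> K" "K \<le> K" "answer (rsc_4 \<iota> K) = rsc_answer \<iota>"
    using K by (simp_all add: rsc_4_def)
next
  fix W S C Q
  assume S: "W \<in> S" "S \<subseteq> indices K" "card S = K" and C: "C \<in> coeff_seqs K"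
    and Q: "Q \<in> set_pmf (query (rsc_4 \<iota> K) W S C)"
  have S_eq: "S = indices K" using S card_subset_eq[of "indices K" S] by simp
  then have "finite S" by simp
  obtain c where "c \<in> set_pmf (pmf_of_set (UNIV - {0, coef S C W}))"
    and Q_eq: "Q = [(sorted_list_of_set S, map ((coef S C)(W := c)) (sorted_list_of_set S))]"
    using Q by (auto simp: rsc_4_def rsc_query_4_def Let_def S_eq)
  note c = set_pmf_of_nonzero_other[OF F this(1)]
  have "map ((coef S C)(W := c)) (sorted_list_of_set S) \<in> coeff_seqs (card S)"
    using \<open>finite S\<close> c C S coef_nonzero by (intro map_nonzero_in_coeff_seqs) auto
  then show "valid_query K 1 Q"
    unfolding Q_eq using S by (intro valid_query_single) auto
  fix x x' :: "nat \<Rightarrow> 'e"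
  assume ans: "\<And>c. c \<in> set Q \<Longrightarrow> component_answer \<iota> x c = component_answer \<iota> x' c"
    and side: "side_info \<iota> S C x = side_info \<iota> S C x'"
  show "x W = x' W"
  proof (rule decode_message[OF emb \<open>finite S\<close> \<open>W \<in> S\<close>, of "coef S C" "(coef S C)(W := c)"])
    show "(\<Sum>i\<in>S. \<iota> (((coef S C)(W := c)) i) * x i) = (\<Sum>i\<in>S. \<iota> (((coef S C)(W := c)) i) * x' i)"
      using ans unfolding Q_eq component_answer_map[OF \<open>finite S\<close>, symmetric] by simp
  qed (use c side in \<open>simp_all add: side_info_def\<close>)
next
  fix W assume W: "W \<in> indices K"
  have "query_law K K (rsc_4 \<iota> K) W = random_subset (K - 1) (indices K - {W}) \<bind>
      (\<lambda>A. pmf_of_set (coeff_seqs K) \<bind> (\<lambda>V. return_pmf [(sorted_list_of_set (indices K), V)]))"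
    unfolding query_law_def
  proof (rule bind_pmf_cong[OF refl])
    fix A assume "A \<in> set_pmf (random_subset (K - 1) (indices K - {W}))"
    then have "A \<subseteq> indices K - {W}" "card A = card (indices K - {W})"
      using W by (simp_all add: subsets_of_size_def)
    then have "A = indices K - {W}"
      by (intro card_subset_eq) simp_all
    \<comment> \<open>For \<open>M = K\<close> the index list is the same for every demand, so only
      the coefficients could reveal it, and they are uniform.\<close>
    then have "insert W A = indices K" using W by auto
    then show "pmf_of_set (coeff_seqs K) \<bind> query (rsc_4 \<iota> K) W (insert W A) =
        pmf_of_set (coeff_seqs K) \<bind> (\<lambda>V. return_pmf [(sorted_list_of_set (indices K), V)])"
      using uniform_coeffs_replaced_bind[OF finite_indices W F, of "\<lambda>V. return_pmf [(sorted_list_of_set (indices K), V)]"]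
      by (simp add: rsc_4_def rsc_query_4_def[abs_def] Let_def)
  qed
  then show "query_law K K (rsc_4 \<iota> K) W =
      pmf_of_set (coeff_seqs K) \<bind> (\<lambda>V. return_pmf [(sorted_list_of_set (indices K), V)])"
    by simp
qed

section \<open>Two query components\<close>

definition decoy_2 :: "nat \<Rightarrow> nat \<Rightarrow> nat \<Rightarrow> nat set \<Rightarrow> nat set pmf" where
  "decoy_2 K M W S = bernoulli_pmf ((2 * real M - 2) / real K) \<bind>
     (\<lambda>own. if own then map_pmf (insert W) (random_subset (M - 2) (indices K - S))
       else random_subset (M - 1) (indices K - S))"

lemma rsc_query_2_decoy:
  "rsc_query_2 K M W S C = decoy_2 K M W S \<bind> (\<lambda>T. random_order
     (sorted_list_of_set (S - {W}), map (coef S C) (sorted_list_of_set (S - {W})))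
     (sorted_list_of_set T, map (coef S C) (sorted_list_of_set (S - {W}))))"
  by (simp add: rsc_query_2_def decoy_2_def bind_assoc_pmf Let_def)

lemma set_decoy_2:
  assumes "W \<in> S" "S \<subseteq> indices K" "card S = M" "3 \<le> M" "2 * M \<le> K + 2" "T \<in> set_pmf (decoy_2 K M W S)"
  shows "T \<subseteq> indices K - (S - {W})" "card T = M - 1"
proof -
  have fin: "finite (indices K - S)" and card: "card (indices K - S) = K - M"
    using assms by (simp_all add: card_Diff_subset finite_subset[OF _ finite_indices])
  have p: "0 \<le> (2 * real M - 2) / real K" "(2 * real M - 2) / real K \<le> 1"
    using assms by (simp_all add: divide_simps)
  from assms(6) obtain own where own: "own \<in> set_pmf (bernoulli_pmf ((2 * real M - 2) / real K))"
    "T \<in> set_pmf (if own then map_pmf (insert W) (random_subset (M - 2) (indices K - S))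
       else random_subset (M - 1) (indices K - S))"
    by (auto simp: decoy_2_def)
  have "T \<subseteq> indices K - (S - {W}) \<and> card T = M - 1"
  proof (cases own)
    case True
    then obtain R where R: "T = insert W R" "R \<subseteq> indices K - S" "card R = M - 2"
      using own(2) fin card assms(5) by (auto simp: subsets_of_size_def)
    moreover from R have "finite R" "W \<notin> R"
      using finite_subset[OF R(2) fin] assms(1) by auto
    ultimately show ?thesis using assms(1,2,4) by auto
  next
    case False
    \<comment> \<open>At the boundary \<open>2 * M = K + 2\<close> this branch would ask for
      \<open>M - 1\<close> elements of a set with \<open>M - 2\<close>. Its coin then has
      probability 0, so a branch that is taken excludes the boundary.\<close>
    then have "pmf (bernoulli_pmf ((2 * real M - 2) / real K)) False \<noteq> 0"
      using own(1) by (simp add: set_pmf_iff)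
    then have "2 * M \<noteq> K + 2"
      using p assms(4) by auto
    then have "M - 1 \<le> K - M" using assms(5) by simp
    then have "T \<subseteq> indices K - S" "card T = M - 1"
      using False own(2) fin card by (simp_all add: subsets_of_size_def)
    then show ?thesis by auto
  qed
  then show "T \<subseteq> indices K - (S - {W})" "card T = M - 1" by auto
qed

definition index_sets_2 :: "nat \<Rightarrow> nat \<Rightarrow> nat \<Rightarrow> (nat set \<times> nat set) pmf" where
  "index_sets_2 K M W =
     random_subset (M - 1) (indices K - {W}) \<bind> (\<lambda>A. map_pmf (Pair A) (decoy_2 K M W (insert W A)))"

text \<open>The decoy set is chosen without looking at \<open>C\<close>, so it can be drawn first;
  the coefficients left after dropping that of \<open>W\<close> are then uniform for any fixed pair
  of index sets.\<close>

lemma query_law_rsc_2: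
  assumes "W \<in> indices K" "3 \<le> M" "M \<le> K"
  shows "query_law K M (rsc_2 (\<iota> :: 'f::{field,finite} \<Rightarrow> 'e::{field,finite}) K M) W =
    pair_query_law (M - 1) (index_sets_2 K M W)"
  unfolding query_law_def pair_query_law_def index_sets_2_def bind_assoc_pmf bind_map_pmf prod.case
proof (rule bind_pmf_cong[OF refl])
  fix A assume "A \<in> set_pmf (random_subset (M - 1) (indices K - {W}))"
  then have A: "A \<subseteq> indices K - {W}" "card A = M - 1"
    using assms by (simp_all add: subsets_of_size_def)
  then have fin: "finite A" by (auto intro: finite_subset[OF _ finite_Diff[OF finite_indices]])
  let ?S = "insert W A"
  have S: "finite ?S" "W \<in> ?S" "card ?S = M" "?S - {W} = A"
    using A fin assms by (auto simp: card_insert_if)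
  let ?h = "\<lambda>V T. random_order (sorted_list_of_set A, V) (sorted_list_of_set T, V)"
  let ?V = "\<lambda>C :: 'f list. map (coef ?S C) (sorted_list_of_set A)"
  have "pmf_of_set (coeff_seqs M) \<bind> query (rsc_2 \<iota> K M) W ?S =
      pmf_of_set (coeff_seqs M) \<bind> (\<lambda>C. decoy_2 K M W ?S \<bind> (\<lambda>T. ?h (?V C) T))"
    by (intro bind_pmf_cong[OF refl]) (simp add: rsc_2_def rsc_query_2_decoy S(4) del: insert_Diff_single insert_Diff1)
  also have "\<dots> = decoy_2 K M W ?S \<bind> (\<lambda>T. pmf_of_set (coeff_seqs M) \<bind> (\<lambda>C. ?h (?V C) T))"
    by (rule bind_commute_pmf)
  also have "\<dots> = decoy_2 K M W ?S \<bind> (\<lambda>T. map_pmf ?V (pmf_of_set (coeff_seqs M)) \<bind> (\<lambda>V. ?h V T))"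
    by (simp add: bind_map_pmf)
  also have "map_pmf ?V (pmf_of_set (coeff_seqs M)) = pmf_of_set (coeff_seqs (M - 1))"
    using uniform_coeffs_removed[OF S(1,2)] unfolding S(3,4) .
  finally show "pmf_of_set (coeff_seqs M) \<bind> query (rsc_2 \<iota> K M) W ?S =
      decoy_2 K M W ?S \<bind> (\<lambda>T. pmf_of_set (coeff_seqs (M - 1)) \<bind> (\<lambda>V. ?h V T))" .
qed

definition disjoint_pair :: "nat \<Rightarrow> nat \<Rightarrow> nat set \<Rightarrow> nat set \<Rightarrow> bool" where
  "disjoint_pair K m A B \<longleftrightarrow>
     A \<subseteq> indices K \<and> B \<subseteq> indices K \<and> card A = m \<and> card B = m \<and> A \<inter> B = {}"

text \<open>The two selection probabilities are calibrated so that a decoy set containing \<open>W\<close> is twice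
  as likely as one avoiding it; an index outside both sets is compatible with both orders of the
  pair, which compensates for the factor.\<close>

lemma pmf_index_sets_2:
  assumes "W \<in> indices K" "3 \<le> M" "2 * M \<le> K + 2"
  defines "c \<equiv> 1 / real (K - 1 choose (M - 1)) * ((2 * real M - 2) / real K / real (K - M choose (M - 2)))"
  shows "pmf (index_sets_2 K M W) (A, B) =
    (if disjoint_pair K (M - 1) A B \<and> W \<notin> A then if W \<in> B then c else c / 2 else 0)"
proof (cases "A \<subseteq> indices K - {W} \<and> card A = M - 1")
  case True
  then have fin: "finite A" by (auto intro: finite_subset[OF _ finite_indices])
  let ?T = "indices K - insert W A" and ?p = "(2 * real M - 2) / real K"
  have p: "0 \<le> ?p" "?p \<le> 1" using assms(2,3) by (simp_all add: divide_simps)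
  have "card (insert W A) = M" using True fin assms(2) by (auto simp: card_insert_if)
  then have card: "card ?T = K - M"
    using True assms(1) fin by (subst card_Diff_subset) auto
  have T: "finite ?T" "W \<notin> ?T" by auto
  have own: "pmf (map_pmf (insert W) (random_subset (M - 2) ?T)) B =
      (if W \<in> B \<and> B \<subseteq> indices K \<and> card B = M - 1 \<and> A \<inter> B = {} then 1 / real (K - M choose (M - 2)) else 0)"
  proof -
    have "Suc (M - 2) = M - 1" "M - 2 \<le> card ?T" using assms(2,3) card by simp_all
    moreover have "B \<subseteq> insert W ?T \<longleftrightarrow> B \<subseteq> indices K \<and> A \<inter> B = {}"
      using True assms(1) by blast
    ultimately show ?thesis
      using pmf_insert_random_subset[OF T(1) _ T(2), of "M - 2" B] unfolding card by simp
  qed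
  have other: "(1 - ?p) * pmf (random_subset (M - 1) ?T) B =
      (if W \<notin> B \<and> B \<subseteq> indices K \<and> card B = M - 1 \<and> A \<inter> B = {}
        then ?p / real (K - M choose (M - 2)) / 2 else 0)"
  proof (cases "M - 1 \<le> K - M")
    case True
    have "Suc (M - 2) = M - 1" using assms(2) by simp
    then have "(real (K - M) - real (M - 2)) / real (K - M choose (M - 1)) =
        real (M - 1) / real (K - M choose (M - 2))"
      using binomial_ratio[of "M - 2" "K - M"] True by simp
    \<comment> \<open>Origin of \<open>?p = (2M-2)/K\<close>: both sides of the binomial ratio
      become multiples of \<open>K\<close>, namely \<open>(1 - ?p) * K\<close> and half of
      \<open>?p * K\<close>.\<close>
    moreover have "real (K - M) - real (M - 2) = (1 - ?p) * real K" "real (M - 1) = ?p / 2 * real K"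
      using assms(2,3) by (simp_all add: of_nat_diff field_simps)
    ultimately have "(1 - ?p) / real (K - M choose (M - 1)) * real K =
        ?p / 2 / real (K - M choose (M - 2)) * real K"
      by (simp only: times_divide_eq_left)
    moreover have "real K \<noteq> 0" using assms(2,3) by simp
    ultimately have "(1 - ?p) / real (K - M choose (M - 1)) = ?p / 2 / real (K - M choose (M - 2))"
      by (simp only: mult_cancel_right) simp
    moreover have "B \<subseteq> ?T \<and> card B = M - 1 \<longleftrightarrow>
        W \<notin> B \<and> B \<subseteq> indices K \<and> card B = M - 1 \<and> A \<inter> B = {}"
      by blast
    ultimately show ?thesis
      using True card T(1) by (simp add: pmf_random_subset)
  next
    case False
    then have K: "K + 2 = 2 * M" using assms(2,3) by simp
    then have p1: "1 - ?p = 0" using assms(2) by (simp add: field_simps)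
    \<comment> \<open>Only \<open>K - M = M - 2\<close> indices lie outside
      \<open>insert W A\<close>, so no decoy set avoiding \<open>W\<close> fits, in accordance with
      the coin probability 0.\<close>
    have no: "\<not> (W \<notin> B \<and> B \<subseteq> indices K \<and> card B = M - 1 \<and> A \<inter> B = {})"
    proof
      assume B: "W \<notin> B \<and> B \<subseteq> indices K \<and> card B = M - 1 \<and> A \<inter> B = {}"
      then have "B \<subseteq> ?T" by blast
      then have "card B \<le> K - M" using card_mono[OF T(1)] card by metis
      then show False using B K assms(2) by simp
    qed
    show ?thesis unfolding p1 if_not_P[OF no] by simp
  qed
  have "pmf (decoy_2 K M W (insert W A)) B =
      (if B \<subseteq> indices K \<and> card B = M - 1 \<and> A \<inter> B = {}
       then (if W \<in> B then ?p / real (K - M choose (M - 2)) else ?p / real (K - M choose (M - 2)) / 2) else 0)"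
    unfolding decoy_2_def pmf_bernoulli_bind[OF p] if_True if_False own other by auto
  moreover have "pmf (random_subset (M - 1) (indices K - {W})) A = 1 / real (K - 1 choose (M - 1))"
    using True assms(1-3) by (simp add: pmf_random_subset)
  ultimately show ?thesis
    using True unfolding index_sets_2_def pmf_bind_pair disjoint_pair_def by (auto simp: c_def)
next
  case False
  have "pmf (random_subset (M - 1) (indices K - {W})) A = 0"
    using False assms(1-3) by (subst pmf_random_subset) auto
  then show ?thesis
    using False unfolding index_sets_2_def pmf_bind_pair disjoint_pair_def by auto
qed

text \<open>If \<open>w\<close> lies in one of the sets, the average is that of \<open>c\<close> and
  0; if it lies in neither, that of \<open>c / 2\<close> and \<open>c / 2\<close>. Disjointness
  excludes a fourth position.\<close>

lemma coin_swap_index_sets_2: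
  assumes "W \<in> indices K" "W' \<in> indices K" "3 \<le> M" "2 * M \<le> K + 2"
  shows "coin_swap (index_sets_2 K M W) = coin_swap (index_sets_2 K M W')"
proof (rule pmf_eqI, clarify)
  fix A B
  define c where "c = 1 / real (K - 1 choose (M - 1)) * ((2 * real M - 2) / real K / real (K - M choose (M - 2)))"
  have "pmf (coin_swap (index_sets_2 K M w)) (A, B) = (if disjoint_pair K (M - 1) A B then c / 2 else 0)"
    if "w \<in> indices K" for w
  proof -
    note pmf = pmf_index_sets_2[OF that assms(3,4), folded c_def]
    have "disjoint_pair K (M - 1) B A = disjoint_pair K (M - 1) A B"
      by (auto simp: disjoint_pair_def)
    moreover have "\<not> (w \<in> A \<and> w \<in> B)" if "disjoint_pair K (M - 1) A B"
      using that by (auto simp: disjoint_pair_def)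
    ultimately show ?thesis
      by (cases "w \<in> A"; cases "w \<in> B") (auto simp: pmf_coin_swap pmf)
  qed
  then show "pmf (coin_swap (index_sets_2 K M W)) (A, B) = pmf (coin_swap (index_sets_2 K M W')) (A, B)"
    using assms(1,2) by simp
qed

lemma rsc_2_correct:
  fixes \<iota> :: "'f::{field,finite} \<Rightarrow> 'e::{field,finite}"
  assumes emb: "field_embedding \<iota>" and "CARD('e) = q ^ l" "1 \<le> l" "2 \<le> q" and M: "3 \<le> M" "2 * M \<le> K + 2"
  shows "scalar_linear \<iota> K M (rsc_2 \<iota> K M) \<and> pir_csi_II \<iota> K M (rsc_2 \<iota> K M) \<and>
    rate q l K M (rsc_2 \<iota> K M) = 1 / real 2"
proof (rule rsc_protocol_correct[OF assms(1-4)])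
  show "1 \<le> M" "M \<le> K" "answer (rsc_2 \<iota> K M) = rsc_answer \<iota>"
    using M by (simp_all add: rsc_2_def)
next
  fix W S C Q
  assume S: "W \<in> S" "S \<subseteq> indices K" "card S = M" and C: "C \<in> coeff_seqs M"
    and Q: "Q \<in> set_pmf (query (rsc_2 \<iota> K M) W S C)"
  have fin: "finite S" using S(2) by (rule finite_subset) simp
  let ?V = "map (coef S C) (sorted_list_of_set (S - {W}))"
  obtain T where "T \<in> set_pmf (decoy_2 K M W S)" and
    Q_in: "Q \<in> {[(sorted_list_of_set (S - {W}), ?V), (sorted_list_of_set T, ?V)],
      [(sorted_list_of_set T, ?V), (sorted_list_of_set (S - {W}), ?V)]}"
    using Q unfolding rsc_2_def by (auto simp: rsc_query_2_decoy set_random_order)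
  note T = set_decoy_2[OF S M this(1)]
  have card: "card (S - {W}) = M - 1" using S fin by simp
  have "?V \<in> coeff_seqs (card (S - {W}))"
    using fin S C coef_nonzero by (intro map_nonzero_in_coeff_seqs) auto
  then have V: "?V \<in> coeff_seqs (M - 1)" unfolding card .
  \<comment> \<open>The two sets are disjoint, so equality would force both to be empty, against
    \<open>M >= 3\<close>.\<close>
  have "S - {W} \<noteq> T"
  proof
    assume "S - {W} = T"
    then have "S - {W} = {}" using T(1) by blast
    then have "M - 1 = 0" using card by (metis card.empty)
    then show False using M by simp
  qed
  with S T card V Q_in show "valid_query K 2 Q"
    by (intro valid_query_pair[of "S - {W}" K T "M - 1" ?V]) auto
  fix x x' :: "nat \<Rightarrow> 'e"
  assume ans: "\<And>c. c \<in> set Q \<Longrightarrow> component_answer \<iota> x c = component_answer \<iota> x' c"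
    and side: "side_info \<iota> S C x = side_info \<iota> S C x'"
  \<comment> \<open>The decoding component is written as a combination over all of \<open>S\<close>,
    with coefficient 0 at \<open>W\<close>, to be compared with the side information.\<close>
  have sum: "(\<Sum>i\<in>S. \<iota> (((coef S C)(W := 0)) i) * z i) = component_answer \<iota> z (sorted_list_of_set (S - {W}), ?V)" for z
  proof -
    have "(\<Sum>i\<in>S. \<iota> (((coef S C)(W := 0)) i) * z i) = (\<Sum>i\<in>S - {W}. \<iota> (coef S C i) * z i)"
      using fin S(1) field_embedding_0[OF emb] by (simp add: sum.remove[of S W])
    then show ?thesis using fin by (simp add: component_answer_map)
  qed
  show "x W = x' W"
  proof (rule decode_message[OF emb fin S(1), of "coef S C" "(coef S C)(W := 0)"])
    show "(\<Sum>i\<in>S. \<iota> (((coef S C)(W := 0)) i) * x i) = (\<Sum>i\<in>S. \<iota> (((coef S C)(W := 0)) i) * x' i)"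
      unfolding sum using Q_in by (intro ans) auto
    show "coef S C W \<noteq> ((coef S C)(W := 0)) W"
      using coef_nonzero[OF fin S(1)] C S by simp
  qed (use side in \<open>simp_all add: side_info_def\<close>)
next
  fix W assume W: "W \<in> indices K"
  \<comment> \<open>Index 1 serves as an arbitrary reference demand for the common law.\<close>
  have "1 \<in> indices K" using M by (simp add: indices_def)
  then show "query_law K M (rsc_2 \<iota> K M) W = pair_query_law (M - 1) (index_sets_2 K M 1)"
    using W M unfolding query_law_rsc_2[OF W M(1)] pair_query_law_coin_swap
    by (simp add: coin_swap_index_sets_2[of W K 1] query_law_rsc_2 pair_query_law_coin_swap)
qed

section \<open>Case 3: pairs of index sets covering all indices\<close>

definition decoy_3 :: "nat \<Rightarrow> nat \<Rightarrow> nat \<Rightarrow> nat set \<Rightarrow> nat set pmf" where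
  "decoy_3 K M W S = map_pmf (\<lambda>T. T \<union> (indices K - S)) (bernoulli_pmf (1 - (2 * real K - 2 * real M) / real K) \<bind>
     (\<lambda>own. if own then map_pmf (insert W) (random_subset (2 * M - K - 1) (S - {W}))
       else random_subset (2 * M - K) (S - {W})))"

lemma rsc_query_3_decoy:
  "rsc_query_3 K M W S C = decoy_3 K M W S \<bind> (\<lambda>B. pmf_of_set (UNIV - {0, coef S C W}) \<bind> (\<lambda>c. random_order
     (sorted_list_of_set S, map ((coef S C)(W := c)) (sorted_list_of_set S))
     (sorted_list_of_set B, map ((coef S C)(W := c)) (sorted_list_of_set S))))"
  by (simp add: rsc_query_3_def decoy_3_def bind_map_pmf bind_assoc_pmf Let_def)

text \<open>Mirror image of Case 2: now a second set avoiding \<open>W\<close> is twice as likely as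
  one containing it. The constant \<open>c\<close> is the probability \<open>(2M-K)/K\<close> of
  including \<open>W\<close>, divided by the number of ways to complete the selection.\<close>

lemma pmf_decoy_3:
  assumes "W \<in> S" "S \<subseteq> indices K" "card S = M" "K + 1 \<le> 2 * M" "M + 1 \<le> K"
  defines "c \<equiv> real (2 * M - K) / real K / real (M - 1 choose (2 * M - K - 1))"
  shows "pmf (decoy_3 K M W S) B =
    (if B \<subseteq> indices K \<and> card B = M \<and> S \<union> B = indices K then if W \<in> B then c else 2 * c else 0)"
proof -
  let ?p = "1 - (2 * real K - 2 * real M) / real K" and ?m = "2 * M - K"
  let ?mix = "bernoulli_pmf ?p \<bind> (\<lambda>own. if own then map_pmf (insert W) (random_subset (?m - 1) (S - {W}))
       else random_subset ?m (S - {W}))"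
  have fin: "finite S" using assms(2) by (rule finite_subset) simp
  have T: "finite (S - {W})" "W \<notin> S - {W}" "card (S - {W}) = M - 1" using fin assms(1,3) by auto
  have m: "?m - 1 \<le> M - 1" "?m \<le> M - 1" "Suc (?m - 1) = ?m" using assms(4,5) by auto
  have p: "0 \<le> ?p" "?p \<le> 1" using assms(4,5) by (auto simp: field_simps)
  \<comment> \<open>The number \<open>(1 - ?p) * K = 2 (K - M)\<close> is written as twice the
    numerator of the binomial ratio for \<open>M - 1\<close> over \<open>?m\<close>, which produces
    the factor 2.\<close>
  have p_eq: "?p * real K = real ?m" "(1 - ?p) * real K = 2 * (real (M - 1) - real (?m - 1))"
    using assms(4,5) by (auto simp: field_simps of_nat_diff)
  have K0: "real K \<noteq> 0" using assms(5) by simp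
  have w_own: "?p * (1 / real (M - 1 choose (?m - 1))) = c"
  proof -
    have "?p = real ?m / real K" by (rule iffD2[OF nonzero_eq_divide_eq[OF K0] p_eq(1)])
    then show ?thesis unfolding c_def by simp
  qed
  have w_other: "(1 - ?p) * (1 / real (M - 1 choose ?m)) = 2 * c"
  proof -
    have "(1 - ?p) * (1 / real (M - 1 choose ?m)) * real K =
        2 * ((real (M - 1) - real (?m - 1)) / real (M - 1 choose ?m))"
      using p_eq(2) by (metis (no_types, opaque_lifting) mult.commute mult.right_neutral times_divide_eq_left times_divide_eq_right)
    also have "\<dots> = 2 * (real ?m / real (M - 1 choose (?m - 1)))"
      using binomial_ratio[of "?m - 1" "M - 1"] m by simp
    also have "\<dots> = 2 * c * real K"
      using K0 unfolding c_def by simp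
    finally show ?thesis using K0 by (simp only: mult_cancel_right) simp
  qed
  have mix: "pmf ?mix R = (if W \<in> R then if R \<subseteq> S \<and> card R = ?m then c else 0
      else if R \<subseteq> S \<and> card R = ?m then 2 * c else 0)" for R
  proof -
    have "pmf (map_pmf (insert W) (random_subset (?m - 1) (S - {W}))) R =
        (if W \<in> R \<and> R \<subseteq> S \<and> card R = ?m then 1 / real (M - 1 choose (?m - 1)) else 0)"
      using pmf_insert_random_subset[OF T(1) m(1)[folded T(3)] T(2), of R]
      unfolding T(3) m(3) insert_Diff[OF assms(1)] .
    moreover have "pmf (random_subset ?m (S - {W})) R =
        (if W \<notin> R \<and> R \<subseteq> S \<and> card R = ?m then 1 / real (M - 1 choose ?m) else 0)"
      using T m(2) by (subst pmf_random_subset) auto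
    ultimately show ?thesis
      unfolding pmf_bernoulli_bind[OF p] if_True if_False
      by (simp only: if_distrib[of "\<lambda>x. ?p * x"] if_distrib[of "\<lambda>x. (1 - ?p) * x"] w_own w_other) auto
  qed
  have sub: "R \<subseteq> S" if "R \<in> set_pmf ?mix" for R
  proof -
    have "pmf ?mix R \<noteq> 0" using that unfolding set_pmf_iff .
    then show ?thesis unfolding mix by (auto split: if_splits)
  qed
  show ?thesis
  proof (cases "B \<subseteq> indices K \<and> S \<union> B = indices K")
    case True
    \<comment> \<open>The second set contains the whole complement of \<open>S\<close>, so it is
      determined by its trace on \<open>S\<close>, which is the random selection.\<close>
    have "R \<union> (indices K - S) = B \<longleftrightarrow> R = B \<inter> S" if "R \<subseteq> S" for R
      using True that by blast
    then have "pmf (decoy_3 K M W S) B = pmf ?mix (B \<inter> S)"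
      unfolding decoy_3_def using sub by (intro pmf_map_eq) blast
    moreover have "card B = card (B \<inter> S) + (K - M)"
    proof -
      have "finite B" using True finite_subset[of B "indices K"] by simp
      have "B = (B \<inter> S) \<union> (indices K - S)" using True by blast
      then have "card B = card (B \<inter> S) + card (indices K - S)"
        using \<open>finite B\<close> by (metis Diff_disjoint card_Un_disjoint finite_Diff finite_Int finite_indices inf_assoc inf_bot_right inf_commute)
      then show ?thesis using assms(2,3) fin by (simp add: card_Diff_subset)
    qed
    then have "card (B \<inter> S) = ?m \<longleftrightarrow> card B = M"
      using assms(4,5) by arith
    ultimately show ?thesis
      using True assms(1) by (simp add: mix)
  next
    case False
    then have "pmf (decoy_3 K M W S) B = 0"
      unfolding decoy_3_def using sub assms(2) by (intro pmf_map_eq_0) blast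
    then show ?thesis using False by auto
  qed
qed

definition index_sets_3 :: "nat \<Rightarrow> nat \<Rightarrow> nat \<Rightarrow> (nat set \<times> nat set) pmf" where
  "index_sets_3 K M W =
     map_pmf (insert W) (random_subset (M - 1) (indices K - {W})) \<bind> (\<lambda>S. map_pmf (Pair S) (decoy_3 K M W S))"

text \<open>The selection ignores \<open>C\<close>, and the replaced coefficients are uniform, so
  the coefficients sent are independent of the index sets. All \<open>M\<close> coefficients are
  kept here, unlike in Case 2.\<close>

lemma query_law_rsc_3:
  fixes \<iota> :: "'f::{field,finite} \<Rightarrow> 'e::{field,finite}"
  assumes "W \<in> indices K" "1 \<le> M" "M \<le> K" "3 \<le> CARD('f)"
  shows "query_law K M (rsc_3 \<iota> K M) W = pair_query_law M (index_sets_3 K M W)"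
  unfolding query_law_def pair_query_law_def index_sets_3_def bind_assoc_pmf bind_map_pmf prod.case
proof (rule bind_pmf_cong[OF refl])
  fix A assume "A \<in> set_pmf (random_subset (M - 1) (indices K - {W}))"
  then have A: "A \<subseteq> indices K - {W}" "card A = M - 1"
    using assms by (simp_all add: subsets_of_size_def)
  then have fin: "finite A" by (auto intro: finite_subset[OF _ finite_Diff[OF finite_indices]])
  let ?S = "insert W A"
  have S: "finite ?S" "W \<in> ?S" "card ?S = M"
    using A fin assms by (auto simp: card_insert_if)
  let ?h = "\<lambda>T V :: 'f list. random_order (sorted_list_of_set ?S, V) (sorted_list_of_set T, V)"
  have "pmf_of_set (coeff_seqs M) \<bind> query (rsc_3 \<iota> K M) W ?S =
      pmf_of_set (coeff_seqs M) \<bind> (\<lambda>C. decoy_3 K M W ?S \<bind> (\<lambda>T. pmf_of_set (UNIV - {0, coef ?S C W}) \<bind>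
        (\<lambda>c. ?h T (map ((coef ?S C)(W := c)) (sorted_list_of_set ?S)))))"
    by (intro bind_pmf_cong[OF refl]) (simp add: rsc_3_def rsc_query_3_decoy)
  also have "\<dots> = decoy_3 K M W ?S \<bind> (\<lambda>T. pmf_of_set (coeff_seqs M) \<bind> (\<lambda>C. pmf_of_set (UNIV - {0, coef ?S C W}) \<bind>
        (\<lambda>c. ?h T (map ((coef ?S C)(W := c)) (sorted_list_of_set ?S)))))"
    by (rule bind_commute_pmf)
  also have "\<dots> = decoy_3 K M W ?S \<bind> (\<lambda>T. pmf_of_set (coeff_seqs M) \<bind> ?h T)"
  proof (rule bind_pmf_cong[OF refl])
    fix T
    show "pmf_of_set (coeff_seqs M) \<bind> (\<lambda>C. pmf_of_set (UNIV - {0, coef ?S C W}) \<bind>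
        (\<lambda>c. ?h T (map ((coef ?S C)(W := c)) (sorted_list_of_set ?S)))) = pmf_of_set (coeff_seqs M) \<bind> ?h T"
      using uniform_coeffs_replaced_bind[OF S(1,2) assms(4), of "?h T"] unfolding S(3) .
  qed
  finally show "pmf_of_set (coeff_seqs M) \<bind> query (rsc_3 \<iota> K M) W ?S =
      decoy_3 K M W ?S \<bind> (\<lambda>T. pmf_of_set (coeff_seqs M) \<bind> ?h T)" .
qed

definition covering_pair :: "nat \<Rightarrow> nat \<Rightarrow> nat set \<Rightarrow> nat set \<Rightarrow> bool" where
  "covering_pair K m A B \<longleftrightarrow>
     A \<subseteq> indices K \<and> B \<subseteq> indices K \<and> card A = m \<and> card B = m \<and> A \<union> B = indices K"

lemma pmf_index_sets_3:
  assumes "W \<in> indices K" "K + 1 \<le> 2 * M" "M + 1 \<le> K"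
  defines "c \<equiv> 1 / real (K - 1 choose (M - 1)) * (real (2 * M - K) / real K / real (M - 1 choose (2 * M - K - 1)))"
  shows "pmf (index_sets_3 K M W) (A, B) =
    (if covering_pair K M A B \<and> W \<in> A then if W \<in> B then c else 2 * c else 0)"
proof -
  have "pmf (map_pmf (insert W) (random_subset (M - 1) (indices K - {W}))) A =
      (if W \<in> A \<and> A \<subseteq> indices K \<and> card A = M then 1 / real (K - 1 choose (M - 1)) else 0)"
    using assms(1-3) by (subst pmf_insert_random_subset) (auto simp: insert_absorb)
  then show ?thesis
    using pmf_decoy_3[of W A K M B] assms(2,3) unfolding index_sets_3_def pmf_bind_pair c_def covering_pair_def
    by auto
qed

text \<open>If \<open>w\<close> lies in both sets, both orders have weight \<open>c\<close>; if it
  lies in only one, a single order has weight \<open>2 * c\<close>. The average is \<open>c\<close>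
  either way, and covering excludes that \<open>w\<close> lies in neither.\<close>

lemma coin_swap_index_sets_3:
  assumes "W \<in> indices K" "W' \<in> indices K" "K + 1 \<le> 2 * M" "M + 1 \<le> K"
  shows "coin_swap (index_sets_3 K M W) = coin_swap (index_sets_3 K M W')"
proof (rule pmf_eqI, clarify)
  fix A B
  define c where
    "c = 1 / real (K - 1 choose (M - 1)) * (real (2 * M - K) / real K / real (M - 1 choose (2 * M - K - 1)))"
  have "pmf (coin_swap (index_sets_3 K M w)) (A, B) = (if covering_pair K M A B then c else 0)"
    if "w \<in> indices K" for w
  proof -
    note pmf = pmf_index_sets_3[OF that assms(3,4), folded c_def]
    have "covering_pair K M B A = covering_pair K M A B"
      by (auto simp: covering_pair_def)
    moreover have "w \<in> A \<or> w \<in> B" if "covering_pair K M A B"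
      using that \<open>w \<in> indices K\<close> by (auto simp: covering_pair_def)
    ultimately show ?thesis
      by (cases "w \<in> A"; cases "w \<in> B") (auto simp: pmf_coin_swap pmf)
  qed
  then show "pmf (coin_swap (index_sets_3 K M W)) (A, B) = pmf (coin_swap (index_sets_3 K M W')) (A, B)"
    using assms(1,2) by simp
qed

lemma rsc_3_correct:
  fixes \<iota> :: "'f::{field,finite} \<Rightarrow> 'e::{field,finite}"
  assumes emb: "field_embedding \<iota>" and "CARD('e) = q ^ l" "1 \<le> l" "2 \<le> q" and F: "3 \<le> CARD('f)"
    and M: "K + 1 \<le> 2 * M" "M + 1 \<le> K"
  shows "scalar_linear \<iota> K M (rsc_3 \<iota> K M) \<and> pir_csi_II \<iota> K M (rsc_3 \<iota> K M) \<and>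
    rate q l K M (rsc_3 \<iota> K M) = 1 / real 2"
proof (rule rsc_protocol_correct[OF assms(1-4)])
  show "1 \<le> M" "M \<le> K" "answer (rsc_3 \<iota> K M) = rsc_answer \<iota>"
    using M by (simp_all add: rsc_3_def)
next
  fix W S C Q
  assume S: "W \<in> S" "S \<subseteq> indices K" "card S = M" and C: "C \<in> coeff_seqs M"
    and Q: "Q \<in> set_pmf (query (rsc_3 \<iota> K M) W S C)"
  have fin: "finite S" using S(2) by (rule finite_subset) simp
  let ?V = "\<lambda>c. map ((coef S C)(W := c)) (sorted_list_of_set S)"
  obtain B c where B_in: "B \<in> set_pmf (decoy_3 K M W S)" and c_in: "c \<in> set_pmf (pmf_of_set (UNIV - {0, coef S C W}))"
    and Q_in: "Q \<in> {[(sorted_list_of_set S, ?V c), (sorted_list_of_set B, ?V c)],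
      [(sorted_list_of_set B, ?V c), (sorted_list_of_set S, ?V c)]}"
    using Q unfolding rsc_3_def protocol.select_convs rsc_query_3_decoy set_bind_pmf set_random_order by blast
  have "pmf (decoy_3 K M W S) B \<noteq> 0" using B_in by (simp add: set_pmf_iff)
  then have B: "B \<subseteq> indices K" "card B = M" "S \<union> B = indices K"
    unfolding pmf_decoy_3[OF S M] by (auto split: if_splits)
  note c = set_pmf_of_nonzero_other[OF F c_in]
  have "?V c \<in> coeff_seqs (card S)"
    using fin S C c coef_nonzero by (intro map_nonzero_in_coeff_seqs) auto
  then have V: "?V c \<in> coeff_seqs M" unfolding S(3) .
  \<comment> \<open>Two equal covering sets would each contain all \<open>K\<close> indices, against
    \<open>M < K\<close>.\<close>
  have "S \<noteq> B"
  proof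
    assume "S = B"
    then have "card S = K" using B(3) by simp
    then show False using S(3) M by simp
  qed
  with S B V Q_in show "valid_query K 2 Q"
    by (intro valid_query_pair[of S K B M "?V c"]) auto
  fix x x' :: "nat \<Rightarrow> 'e"
  assume ans: "\<And>c. c \<in> set Q \<Longrightarrow> component_answer \<iota> x c = component_answer \<iota> x' c"
    and side: "side_info \<iota> S C x = side_info \<iota> S C x'"
  show "x W = x' W"
  proof (rule decode_message[OF emb fin S(1), of "coef S C" "(coef S C)(W := c)"])
    show "(\<Sum>i\<in>S. \<iota> (((coef S C)(W := c)) i) * x i) = (\<Sum>i\<in>S. \<iota> (((coef S C)(W := c)) i) * x' i)"
      unfolding component_answer_map[OF fin, symmetric] using Q_in by (intro ans) auto
  qed (use side c in \<open>simp_all add: side_info_def\<close>)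
next
  fix W assume W: "W \<in> indices K"
  have 1: "1 \<in> indices K" using M by (simp add: indices_def)
  have "query_law K M (rsc_3 \<iota> K M) W = pair_query_law M (index_sets_3 K M W)"
    using M by (intro query_law_rsc_3[OF W _ _ F]) simp_all
  then show "query_law K M (rsc_3 \<iota> K M) W = pair_query_law M (index_sets_3 K M 1)"
    unfolding pair_query_law_coin_swap coin_swap_index_sets_3[OF W 1 M] .
qed

theorem lemma11:
  fixes \<iota> :: "'f::{field,finite} \<Rightarrow> 'e::{field,finite}"
    and K M q l :: nat
  assumes "2 \<le> M" and "M \<le> K"
    and "primepow q" and "1 \<le> l"
    and "CARD('f) = q" and "CARD('e) = q ^ l"
    and "field_embedding \<iota>"
  shows
    "(M = 2 \<and> 2 \<le> q \<longrightarrow>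
        scalar_linear \<iota> K M (rsc_1 \<iota> K) \<and> pir_csi_II \<iota> K M (rsc_1 \<iota> K) \<and>
        rate q l K M (rsc_1 \<iota> K) = 1) \<and>
     (3 \<le> M \<and> real M \<le> real K / 2 + 1 \<and> 2 \<le> q \<longrightarrow>
        scalar_linear \<iota> K M (rsc_2 \<iota> K M) \<and> pir_csi_II \<iota> K M (rsc_2 \<iota> K M) \<and>
        rate q l K M (rsc_2 \<iota> K M) = 1 / 2) \<and>
     ((real K + 1) / 2 \<le> real M \<and> real M \<le> real K - 1 \<and> 3 \<le> q \<longrightarrow>
        scalar_linear \<iota> K M (rsc_3 \<iota> K M) \<and> pir_csi_II \<iota> K M (rsc_3 \<iota> K M) \<and>
        rate q l K M (rsc_3 \<iota> K M) = 1 / 2) \<and>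
     (M = K \<and> 3 \<le> q \<longrightarrow>
        scalar_linear \<iota> K M (rsc_4 \<iota> K) \<and> pir_csi_II \<iota> K M (rsc_4 \<iota> K) \<and>
        rate q l K M (rsc_4 \<iota> K) = 1)"
proof (intro conjI[of "_ \<longrightarrow> _"] impI)
  assume "M = 2 \<and> 2 \<le> q"
  then show "scalar_linear \<iota> K M (rsc_1 \<iota> K) \<and> pir_csi_II \<iota> K M (rsc_1 \<iota> K) \<and> rate q l K M (rsc_1 \<iota> K) = 1"
    using rsc_1_correct[OF assms(7,6,4), of K] assms by simp
next
  assume *: "3 \<le> M \<and> real M \<le> real K / 2 + 1 \<and> 2 \<le> q"
  then have "2 * M \<le> K + 2" by linarith
  then show "scalar_linear \<iota> K M (rsc_2 \<iota> K M) \<and> pir_csi_II \<iota> K M (rsc_2 \<iota> K M) \<and>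
      rate q l K M (rsc_2 \<iota> K M) = 1 / 2"
    using rsc_2_correct[OF assms(7,6,4), of M K] * by simp
next
  assume *: "(real K + 1) / 2 \<le> real M \<and> real M \<le> real K - 1 \<and> 3 \<le> q"
  then have "real (K + 1) \<le> real (2 * M)" "real (M + 1) \<le> real K" by auto
  then have "K + 1 \<le> 2 * M" "M + 1 \<le> K" by (simp_all only: of_nat_le_iff)
  then show "scalar_linear \<iota> K M (rsc_3 \<iota> K M) \<and> pir_csi_II \<iota> K M (rsc_3 \<iota> K M) \<and>
      rate q l K M (rsc_3 \<iota> K M) = 1 / 2"
    using rsc_3_correct[OF assms(7,6,4), of K M] assms(5) * by simp
next
  assume "M = K \<and> 3 \<le> q"
  then show "scalar_linear \<iota> K M (rsc_4 \<iota> K) \<and> pir_csi_II \<iota> K M (rsc_4 \<iota> K) \<and> rate q l K M (rsc_4 \<iota> K) = 1"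
    using rsc_4_correct[OF assms(7,6,4), of K] assms by simp
qed

end
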